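(* Let $d,n_u,n_v,K$ be positive integers, $\epsilon\in(0,1/2)$, let $U\subset\mathbf{R}^{n_u}$ and $V\subset\mathbf{R}^{n_v}$ be nonempty convex compact sets, $A\in\mathbf{R}^{d\times n_u}$, $a\in\mathbf{R}^d$, $g\in\mathbf{R}^{n_u}$, and let $v\mapsto M(v)$ be an affine mapping from $\mathbf{R}^{n_v}$ to the space of symmetric $d\times d$ matrices with $M(v)\succ0$ for all $v\in V$. Set $\phi_U(h)=\max_{u\in U}u^Th$ and $$\mathrm{Opt}=\min_{f\in\mathbf{R}^d}\left\{\tfrac12\left[\phi_U(A^Tf-g)+\phi_U(-A^Tf+g)\right]+\max_{v\in V}\left[2K^{-1}\ln(2/\epsilon)f^TM(v)f\right]^{1/2}\right\},$$ and let $f_*$ be an optimal solution to this problem. Consider the affine estimate $$\widehat g_*(\omega^K)=\frac1K\sum_{i=1}^Kf_*^T\omega_i+\varkappa_*,\qquad\varkappa_*=\tfrac12\left[\phi_U(-A^Tf_*+g)-\phi_U(A^Tf_*-g)\right]-a^Tf_*.$$ Then the minimax optimal $\epsilon$-risk $$\mathrm{Risk}^{\mathrm{opt}}_\epsilon(K)=\inf_{\widehat g(\cdot)}\mathrm{Risk}_\epsilon(\widehat g(\cdot))$$ of recovering $g^Tu$ from $K$ i.i.d. sub-Gaussian observations with parameters $(Au+a,M(v))$, $(u,v)\in U\times V$ (infimum over all Borel functions $\widehat g:\mathbf{R}^{Kd}\to\mathbf{R}$), is within a moderate factor of the upper bound $\mathrm{Opt}$ on the $\epsilon$-risk of $\widehat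 g_*$. Namely, $\mathrm{Risk}_\epsilon(\widehat g_* )\le\mathrm{Opt}$ and $$\mathrm{Opt}\le\frac{\sqrt{2\ln(2/\epsilon)}}{q_{\mathcal N}(1-\epsilon)}\,\mathrm{Risk}^{\mathrm{opt}}_\epsilon(K),$$ where $q_{\mathcal N}(s)$ is the $s$-quantile of the standard normal distribution, and the factor $\frac{\sqrt{2\ln(2/\epsilon)}}{q_{\mathcal N}(1-\epsilon)}\to1$ as $\epsilon\to0$.
   Context: For $\theta\in\mathbf{R}^d$ and a symmetric positive semidefinite $d\times d$ matrix $\Theta$, $\mathcal{SG}(\theta,\Theta)$ is the family of all Borel probability distributions $P$ on $\mathbf{R}^d$ such that $\ln\left(\mathbf{E}_{\zeta\sim P}\{\exp\{f^T\zeta\}\}\right)\le f^T\theta+\frac12f^T\Theta f$ for all $f\in\mathbf{R}^d$. $P^K$ is the distribution of an i.i.d. sample $\omega^K=(\omega_1,\dots,\omega_K)$ with $\omega_i\sim P$. For a Borel function $\widehat g:\mathbf{R}^{Kd}\to\mathbf{R}$, $\mathrm{Risk}_\epsilon(\widehat g)$ is the smallest $\rho$ such that $\mathrm{Prob}_{\omega^K\sim P^K}\{|\widehat g(\omega^K)-g^Tu|>\rho\}\le\epsilon$ for all $(u,v)\in U\times V$ and all $P\in\mathcal{SG}(Au+a,M(v))$. *)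

theory Defs
  imports "HOL-Probability.Probability"
begin

definition pos_def :: "real^'n^'n \<Rightarrow> bool" where
  "pos_def B \<longleftrightarrow> transpose B = B \<and> (\<forall>x. x \<noteq> 0 \<longrightarrow> 0 < x \<bullet> (B *v x))"

definition affine_map :: "('a::real_vector \<Rightarrow> 'b::real_vector) \<Rightarrow> bool" where
  "affine_map F \<longleftrightarrow> (\<exists>L c. linear L \<and> (\<forall>x. F x = L x + c))"

text \<open>
  The inequality for the logarithm of the moment generating function includes finiteness
  of the expectation. Integrability has to be required separately, since the Bochner
  integral of a non-integrable function is 0 and \<open>ln 0 = 0\<close>.
\<close>
definition sub_gaussian :: "real^'d \<Rightarrow> real^'d^'d \<Rightarrow> (real^'d) measure set" where
  "sub_gaussian \<theta> \<Theta> = {P. prob_space P \<and> sets P = sets borel \<and>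
     (\<forall>f. integrable P (\<lambda>\<zeta>. exp (f \<bullet> \<zeta>)) \<and>
          ln (\<integral>\<zeta>. exp (f \<bullet> \<zeta>) \<partial>P) \<le> f \<bullet> \<theta> + (1/2) * (f \<bullet> (\<Theta> *v f)))}"

text \<open>
  A sample \<open>\<omega>\<^sub>1, \<dots>, \<omega>\<^sub>K\<close> is an (extensional) function on the index set \<open>{..<K}\<close>.
\<close>
abbreviation iid_sample :: "nat \<Rightarrow> 'a measure \<Rightarrow> (nat \<Rightarrow> 'a) measure" where
  "iid_sample K P \<equiv> PiM {..<K} (\<lambda>_. P)"

abbreviation borel_estimates :: "nat \<Rightarrow> ((nat \<Rightarrow> real^'d) \<Rightarrow> real) set" where
  "borel_estimates K \<equiv> borel_measurable (iid_sample K (borel :: (real^'d) measure))"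

text \<open>
  The risk is the smallest admissible \<open>\<rho>\<close>. The set of admissible \<open>\<rho>\<close> is closed (each
  tail probability is right-continuous in \<open>\<rho>\<close>), so its infimum is attained unless the set
  is empty, in which case the risk is \<open>\<infinity>\<close>.
\<close>
definition eps_risk ::
  "(real^'n) set \<Rightarrow> (real^'m) set \<Rightarrow> real^'n^'d \<Rightarrow> real^'d \<Rightarrow> real^'n \<Rightarrow>
   (real^'m \<Rightarrow> real^'d^'d) \<Rightarrow> nat \<Rightarrow> real \<Rightarrow> ((nat \<Rightarrow> real^'d) \<Rightarrow> real) \<Rightarrow> ereal" where
  "eps_risk U V A a g M K \<epsilon> est = Inf (ereal ` {\<rho>.
     \<forall>u\<in>U. \<forall>v\<in>V. \<forall>P\<in>sub_gaussian (A *v u + a) (M v).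
       measure (iid_sample K P) {\<omega> \<in> space (iid_sample K P). \<bar>est \<omega> - g \<bullet> u\<bar> > \<rho>} \<le> \<epsilon>})"

definition minimax_risk ::
  "(real^'n) set \<Rightarrow> (real^'m) set \<Rightarrow> real^'n^'d \<Rightarrow> real^'d \<Rightarrow> real^'n \<Rightarrow>
   (real^'m \<Rightarrow> real^'d^'d) \<Rightarrow> nat \<Rightarrow> real \<Rightarrow> ereal" where
  "minimax_risk U V A a g M K \<epsilon> = (INF est\<in>borel_estimates K. eps_risk U V A a g M K \<epsilon> est)"

text \<open>
  The suprema in the next two definitions are maxima when \<open>U\<close> and \<open>V\<close> are nonempty and
  compact and \<open>M\<close> is continuous.
\<close>
definition support_fun :: "(real^'n) set \<Rightarrow> real^'n \<Rightarrow> real" where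
  "support_fun U h = (SUP u\<in>U. u \<bullet> h)"

definition est_objective ::
  "(real^'n) set \<Rightarrow> (real^'m) set \<Rightarrow> real^'n^'d \<Rightarrow> real^'n \<Rightarrow>
   (real^'m \<Rightarrow> real^'d^'d) \<Rightarrow> nat \<Rightarrow> real \<Rightarrow> real^'d \<Rightarrow> real" where
  "est_objective U V A g M K \<epsilon> f =
     (1/2) * (support_fun U (transpose A *v f - g) + support_fun U (- (transpose A *v f) + g))
     + (SUP v\<in>V. sqrt (2 / real K * ln (2/\<epsilon>) * (f \<bullet> (M v *v f))))"

definition est_opt ::
  "(real^'n) set \<Rightarrow> (real^'m) set \<Rightarrow> real^'n^'d \<Rightarrow> real^'n \<Rightarrow>
   (real^'m \<Rightarrow> real^'d^'d) \<Rightarrow> nat \<Rightarrow> real \<Rightarrow> real" where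
  "est_opt U V A g M K \<epsilon> = (INF f. est_objective U V A g M K \<epsilon> f)"

definition affine_estimate ::
  "(real^'n) set \<Rightarrow> real^'n^'d \<Rightarrow> real^'d \<Rightarrow> real^'n \<Rightarrow> nat \<Rightarrow> real^'d \<Rightarrow>
   (nat \<Rightarrow> real^'d) \<Rightarrow> real" where
  "affine_estimate U A a g K f \<omega> =
     (1 / real K) * (\<Sum>i<K. f \<bullet> \<omega> i)
     + ((1/2) * (support_fun U (- (transpose A *v f) + g) - support_fun U (transpose A *v f - g))
        - a \<bullet> f)"

definition std_normal_quantile :: "real \<Rightarrow> real" where
  "std_normal_quantile s = Inf {x. s \<le> cdf std_normal_distribution x}"

end

theory Submission
  imports Defs "HOL-Real_Asymp.Real_Asymp"
begin

text \<open>
  The objective is a maximum of affine functions. Its first term is half the largest value of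
  \<open>(u - u') \<bullet> (transpose A *v f - g)\<close> over pairs of points of \<open>U\<close>, and its noise term is
  \<open>sqrt (2 / K * ln (2 / \<epsilon>))\<close> times the support function of a compact convex set of noise directions \<open>z\<close>:
  those with \<open>(f \<bullet> z)\<^sup>2 \<le> f \<bullet> (M v *v f)\<close> for some \<open>v\<close> in \<open>V\<close> and all \<open>f\<close>.

  Existence of a minimiser: the objective is convex and coercive (\<open>objective_attains_min\<close>).

  Upper bound: for every \<open>f\<close> the error of the affine estimate splits into a bias, of size at most the
  first term of the objective, and the noise of a sample mean, which Chernoff's bound controls by the
  second term (\<open>risk_affine_estimate_le_objective\<close>).

  Lower bound: separating two convex sets dualises the minimisation
  (\<open>worst_case_pair\<close>). There are points \<open>u\<close>, \<open>u'\<close> of \<open>U\<close> and a noise direction \<open>z\<close> such that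
  \<open>g \<bullet> (u' - u)\<close> is at least twice the optimal value, while \<open>A *v (u' - u)\<close> is
  \<open>2 * sqrt (2 / K * ln (2 / \<epsilon>))\<close> times \<open>z\<close>. Since the noise may be a standard
  normal variable multiplied by \<open>z\<close>, telling \<open>u\<close> from \<open>u'\<close> amounts to testing between the means 
  \<open>\<plusminus> sqrt (2 / K * ln (2 / \<epsilon>))\<close> from \<open>K\<close>
  normal observations of variance 1. Shrinking the pair about its midpoint by a factor \<open>\<kappa>\<close> below
  \<open>std_normal_quantile (1 - \<epsilon>) / sqrt (2 * ln (2 / \<epsilon>))\<close>, which is at most 1, makes the sum of the
  two error probabilities of every test exceed \<open>2 * \<epsilon>\<close> (\<open>two_point_testing_bound\<close>), so no estimate has an
  \<open>\<epsilon>\<close>-risk below \<open>\<kappa>\<close> times the optimal value (\<open>two_point_risk_bound\<close>).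

  The limit of the factor is a matter of normal tails: for \<open>x \<ge> 0\<close>, \<open>1 - cdf std_normal_distribution x\<close> lies between
  \<open>exp (- (x + 1)\<^sup>2 / 2) / sqrt (2 * pi)\<close> and \<open>exp (- x\<^sup>2 / 2)\<close>.
\<close>

section \<open>The standard normal distribution and its quantiles\<close>

text \<open>
  The abbreviation at \<open>\<mu> = 0\<close> is the same term as \<open>std_normal_distribution\<close>, so every fact
  about \<open>normal_dist\<close> specialises to the standard normal distribution without rewriting.
\<close>
abbreviation normal_dist :: "real \<Rightarrow> real measure" where
  "normal_dist \<mu> \<equiv> density lborel (\<lambda>x. ennreal (normal_density \<mu> 1 x))"

lemma prob_space_normal_dist: "prob_space (normal_dist \<mu>)"
  by (rule prob_space_normal_density) simp

text \<open>
  Completing the square: exponential tilting of a unit-variance normal density is a shift of its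
  mean. This one identity yields the moment generating function and also the likelihood ratio of
  two normal distributions.
\<close>
lemma exp_times_normal_density:
  "exp (s * x) * normal_density \<mu> 1 x = exp (s * \<mu> + s\<^sup>2 / 2) * normal_density (\<mu> + s) 1 x"
proof -
  have "s * x + - (x - \<mu>)\<^sup>2 / 2 = (s * \<mu> + s\<^sup>2 / 2) + - (x - (\<mu> + s))\<^sup>2 / 2"
    by (simp add: power2_eq_square field_simps)
  then have "exp (s * x) * exp (- (x - \<mu>)\<^sup>2 / 2)
      = exp (s * \<mu> + s\<^sup>2 / 2) * exp (- (x - (\<mu> + s))\<^sup>2 / 2)"
    by (simp flip: exp_add)
  then show ?thesis
    by (simp add: normal_density_def)
qed

lemma normal_dist_mgf:
  shows "integrable (normal_dist \<mu>) (\<lambda>x. exp (s * x))"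
    and "(\<integral>x. exp (s * x) \<partial>normal_dist \<mu>) = exp (s * \<mu> + s\<^sup>2 / 2)"
proof -
  have eq: "(\<lambda>x. normal_density \<mu> 1 x *\<^sub>R exp (s * x))
      = (\<lambda>x. exp (s * \<mu> + s\<^sup>2 / 2) * normal_density (\<mu> + s) 1 x)"
    by (rule ext) (simp add: exp_times_normal_density[symmetric])
  show "integrable (normal_dist \<mu>) (\<lambda>x. exp (s * x))"
    by (subst integrable_density) (simp_all only: eq, simp_all)
  show "(\<integral>x. exp (s * x) \<partial>normal_dist \<mu>) = exp (s * \<mu> + s\<^sup>2 / 2)"
    by (subst integral_density) (simp_all only: eq, simp_all)
qed

lemma cdf_std_normal_compl:
  "measure std_normal_distribution {x<..} = 1 - cdf std_normal_distribution x"
proof -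
  interpret prob_space std_normal_distribution
    by (rule prob_space_normal_dist)
  have "{x<..} = space std_normal_distribution - {..x}" by auto
  then show ?thesis
    unfolding cdf_def by (subst prob_compl[symmetric]) auto
qed

text \<open>
  Chernoff's bound with the exponent \<open>x\<close>, which minimises \<open>exp (s\<^sup>2 / 2 - s * x)\<close> over \<open>s\<close>.
\<close>
lemma std_normal_upper_tail:
  assumes "0 \<le> x"
  shows "1 - cdf std_normal_distribution x \<le> exp (- x\<^sup>2 / 2)"
proof (cases "x = 0")
  case True
  then show ?thesis by (simp add: cdf_def)
next
  case False
  with assms have x: "x > 0" by simp
  interpret prob_space std_normal_distribution
    by (rule prob_space_normal_dist)
  have sp: "space std_normal_distribution = UNIV" by simp
  have "1 - cdf std_normal_distribution x \<le> measure std_normal_distribution {y \<in> UNIV. x \<le> y}"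
    unfolding cdf_std_normal_compl[symmetric] by (rule finite_measure_mono) auto
  also have "\<dots> \<le> exp (- x * x) * (\<integral>y\<in>UNIV. exp (x * y) \<partial>std_normal_distribution)"
    using normal_dist_mgf(1)[of 0 x] x
    by (intro Chernoff_ineq_ge) (auto simp: set_integrable_def)
  also have "(\<integral>y\<in>UNIV. exp (x * y) \<partial>std_normal_distribution) = exp (x\<^sup>2 / 2)"
    using normal_dist_mgf(2)[of 0 x] by (simp add: set_lebesgue_integral_def)
  also have "exp (- x * x) * exp (x\<^sup>2 / 2) = exp (- x\<^sup>2 / 2)"
    by (simp add: power2_eq_square flip: exp_add)
  finally show ?thesis .
qed

lemma measure_normal_dist_reflect:
  assumes "S \<in> sets borel"
  shows "measure (normal_dist (- \<mu>)) (uminus ` S) = measure (normal_dist \<mu>) S"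
proof -
  interpret prob_space "normal_dist \<mu>" by (rule prob_space_normal_dist)
  have "distributed (normal_dist \<mu>) lborel (\<lambda>x. x) (normal_density \<mu> 1)"
    by (auto simp: distributed_def distr_id2)
  then have "distributed (normal_dist \<mu>) lborel (\<lambda>x. 0 + (- 1) * x)
      (normal_density (0 + (- 1) * \<mu>) (\<bar>- 1\<bar> * 1))"
    by (rule normal_density_affine) auto
  then have *: "normal_dist (- \<mu>) = distr (normal_dist \<mu>) lborel uminus"
    by (simp add: distributed_def)
  have "uminus ` S \<in> sets borel"
  proof -
    have "uminus ` S = uminus -` S \<inter> space borel" by force
    also have "\<dots> \<in> sets borel"
      using assms by (intro measurable_sets) auto
    finally show ?thesis .
  qed
  then show ?thesis
    unfolding * by (subst measure_distr) (auto simp: image_image inj_vimage_image_eq)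
qed

lemma cdf_std_normal_minus:
  "cdf std_normal_distribution (- x) = 1 - cdf std_normal_distribution x"
proof -
  have "measure std_normal_distribution {..- x} = measure std_normal_distribution {x..}"
    using measure_normal_dist_reflect[of "{x..}" 0] by simp
  also have "\<dots> = measure std_normal_distribution {x<..}"
  proof (rule measure_eq_AE)
    show "AE y in std_normal_distribution. (y \<in> {x..}) = (y \<in> {x<..})"
      using AE_lborel_singleton[of x] by (auto simp: AE_density elim!: eventually_mono)
  qed auto
  finally show ?thesis
    unfolding cdf_std_normal_compl by (simp add: cdf_def)
qed

lemma cdf_std_normal_0: "cdf std_normal_distribution 0 = 1 / 2"
  using cdf_std_normal_minus[of 0] by simp

lemma measure_density_lborel_interval_bounds:
  fixes p :: "real \<Rightarrow> real"
  assumes "a \<le> b" "0 \<le> l" and [measurable]: "p \<in> borel_measurable borel"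
    and p: "\<And>x. a < x \<Longrightarrow> x \<le> b \<Longrightarrow> l \<le> p x \<and> p x \<le> u"
  shows "l * (b - a) \<le> measure (density lborel p) {a<..b}"
    and "measure (density lborel p) {a<..b} \<le> u * (b - a)"
proof -
  let ?e = "emeasure (density lborel p) {a<..b}"
  have e: "?e = (\<integral>\<^sup>+x. ennreal (p x) * indicator {a<..b} x \<partial>lborel)"
    by (subst emeasure_density) auto
  have const: "(\<integral>\<^sup>+x. ennreal c * indicator {a<..b} x \<partial>lborel) = ennreal (c * (b - a))"
    if "0 \<le> c" for c
    using assms(1) that by (subst nn_integral_cmult_indicator) (auto simp: ennreal_mult)
  have u: "0 \<le> u" if "a < b"
    using p[of b] that assms(2) by auto
  have up: "?e \<le> ennreal (u * (b - a))"
  proof (cases "a < b")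
    case True
    have "?e \<le> (\<integral>\<^sup>+x. ennreal u * indicator {a<..b} x \<partial>lborel)"
      unfolding e using p
      by (intro nn_integral_mono) (auto simp: indicator_def intro!: ennreal_leI)
    then show ?thesis using const[OF u[OF True]] by simp
  next
    case False
    then show ?thesis by simp
  qed
  have "0 \<le> u * (b - a)"
    using u assms(1) by (cases "a < b") auto
  with up show "measure (density lborel p) {a<..b} \<le> u * (b - a)"
    unfolding measure_def by (metis enn2real_leI)
  have "ennreal (l * (b - a)) \<le> ?e"
    unfolding e const[OF assms(2), symmetric] using p
    by (intro nn_integral_mono) (auto simp: indicator_def intro!: ennreal_leI)
  moreover have "?e < top"
    using up by (rule le_less_trans) simp
  ultimately show "l * (b - a) \<le> measure (density lborel p) {a<..b}"
    unfolding measure_def using assms(1,2)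
    by (metis enn2real_ennreal enn2real_mono mult_nonneg_nonneg diff_ge_0_iff_ge)
qed

lemma std_normal_density_antimono:
  assumes "0 \<le> x" "x \<le> y"
  shows "std_normal_density y \<le> std_normal_density x"
  using power_mono[OF assms(2,1), of 2]
  by (auto simp: std_normal_density_def intro!: divide_right_mono)

text \<open>
  A crude bound (the density is at most 1), whose purpose is to keep the quantiles of levels above
  one half away from 0.
\<close>
lemma cdf_std_normal_le_linear:
  assumes "0 \<le> x"
  shows "cdf std_normal_distribution x \<le> 1 / 2 + x"
proof -
  interpret real_distribution std_normal_distribution
    by (rule real_dist_normal_dist)
  have "cdf std_normal_distribution x - 1 / 2 = measure std_normal_distribution {0<..x}"
    using assms cdf_diff_eq[of 0 x] cdf_std_normal_0 by (cases "x = 0") auto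
  also have "\<dots> \<le> 1 * (x - 0)"
  proof (rule measure_density_lborel_interval_bounds)
    fix y :: real
    have "exp (- (y\<^sup>2 / 2)) \<le> 1" by simp
    also have "1 \<le> sqrt (2 * pi)" using pi_gt3 by simp
    finally show "0 \<le> std_normal_density y \<and> std_normal_density y \<le> 1"
      by (simp add: std_normal_density_def divide_le_eq_1)
  qed (use assms in auto)
  finally show ?thesis by simp
qed

text \<open>
  The tail beyond \<open>x\<close> contains the interval of length 1 that follows \<open>x\<close>, and the density is
  decreasing there. The bound loses only a lower-order term in the exponent, which is all that the
  asymptotics of the quantile requires.
\<close>
lemma std_normal_lower_tail:
  assumes "0 \<le> x"
  shows "exp (- (x + 1)\<^sup>2 / 2) / sqrt (2 * pi) \<le> 1 - cdf std_normal_distribution x"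
proof -
  interpret real_distribution std_normal_distribution
    by (rule real_dist_normal_dist)
  have "std_normal_density (x + 1) * ((x + 1) - x) \<le> measure std_normal_distribution {x<..x + 1}"
    using assms
    by (intro measure_density_lborel_interval_bounds(1)[where u = "std_normal_density x"])
       (auto intro!: std_normal_density_antimono)
  also have "\<dots> \<le> measure std_normal_distribution {x<..}"
    by (rule finite_measure_mono) auto
  finally show ?thesis
    unfolding cdf_std_normal_compl by (simp add: std_normal_density_def)
qed

lemma nonneg_if_cdf_std_normal_gt_half:
  assumes "1 / 2 < cdf std_normal_distribution x"
  shows "0 \<le> x"
proof -
  interpret real_distribution std_normal_distribution
    by (rule real_dist_normal_dist)
  show ?thesis
    using cdf_nondecreasing[of x 0] cdf_std_normal_0 assms by fastforce
qed

text \<open>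
  A point strictly below an infimum lies outside the set. The strict inequality is what turns the
  two-point bound into a contradiction.
\<close>
lemma cdf_less_if_less_std_normal_quantile:
  assumes "1 / 2 < s" "x < std_normal_quantile s"
  shows "cdf std_normal_distribution x < s"
proof (rule ccontr)
  assume "\<not> ?thesis"
  then have "x \<in> {x. s \<le> cdf std_normal_distribution x}" by simp
  moreover have "bdd_below {x. s \<le> cdf std_normal_distribution x}"
    by (rule bdd_belowI[of _ 0]) (use assms(1) nonneg_if_cdf_std_normal_gt_half in auto)
  ultimately have "std_normal_quantile s \<le> x"
    unfolding std_normal_quantile_def by (rule cInf_lower)
  with assms(2) show False by simp
qed

lemma std_normal_quantile_bounds:
  assumes "0 < \<delta>" "\<delta> < 1 / 2"
  shows "0 < std_normal_quantile (1 - \<delta>)"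
    and "std_normal_quantile (1 - \<delta>) \<le> sqrt (2 * ln (1 / \<delta>))"
    and "sqrt (2 * ln (1 / (\<delta> * sqrt (2 * pi)))) - 1 \<le> std_normal_quantile (1 - \<delta>)"
proof -
  define S where "S = {x. 1 - \<delta> \<le> cdf std_normal_distribution x}"
  have q: "std_normal_quantile (1 - \<delta>) = Inf S"
    by (simp add: std_normal_quantile_def S_def)
  have nonneg: "0 \<le> x" if "x \<in> S" for x
    using that assms nonneg_if_cdf_std_normal_gt_half[of x] by (simp add: S_def)
  have "sqrt (2 * ln (1 / \<delta>)) \<in> S"
  proof -
    have pos: "0 \<le> 2 * ln (1 / \<delta>)" using assms by simp
    have "1 - cdf std_normal_distribution (sqrt (2 * ln (1 / \<delta>)))
        \<le> exp (- (sqrt (2 * ln (1 / \<delta>)))\<^sup>2 / 2)"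
      by (rule std_normal_upper_tail) (use pos in simp)
    also have "\<dots> = \<delta>"
      using pos assms by (simp add: ln_div)
    finally show ?thesis by (simp add: S_def)
  qed
  then have ne: "S \<noteq> {}" by auto
  show "std_normal_quantile (1 - \<delta>) \<le> sqrt (2 * ln (1 / \<delta>))"
    unfolding q using nonneg by (intro cInf_lower \<open>_ \<in> S\<close> bdd_belowI)
  have "1 / 2 - \<delta> \<le> Inf S"
  proof (rule cInf_greatest[OF ne])
    fix x assume "x \<in> S"
    then show "1 / 2 - \<delta> \<le> x"
      using cdf_std_normal_le_linear[OF nonneg] by (fastforce simp: S_def)
  qed
  then show "0 < std_normal_quantile (1 - \<delta>)"
    unfolding q using assms by simp
  show "sqrt (2 * ln (1 / (\<delta> * sqrt (2 * pi)))) - 1 \<le> std_normal_quantile (1 - \<delta>)"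
    unfolding q
  proof (rule cInf_greatest[OF ne])
    fix x assume x: "x \<in> S"
    have "exp (- (x + 1)\<^sup>2 / 2) / sqrt (2 * pi) \<le> \<delta>"
      using std_normal_lower_tail[OF nonneg[OF x]] x by (simp add: S_def)
    then have "exp (- (x + 1)\<^sup>2 / 2) \<le> \<delta> * sqrt (2 * pi)"
      by (simp add: field_simps)
    then have "- (x + 1)\<^sup>2 / 2 \<le> ln (\<delta> * sqrt (2 * pi))"
      using assms by (subst ln_ge_iff) auto
    then have "2 * ln (1 / (\<delta> * sqrt (2 * pi))) \<le> (x + 1)\<^sup>2"
      using assms by (simp add: ln_div)
    then have "sqrt (2 * ln (1 / (\<delta> * sqrt (2 * pi)))) \<le> x + 1"
      using nonneg[OF x] by (intro real_le_lsqrt) auto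
    then show "sqrt (2 * ln (1 / (\<delta> * sqrt (2 * pi)))) - 1 \<le> x" by simp
  qed
qed

text \<open>
  By the preceding bounds the quantile lies between two functions asymptotic to
  \<open>sqrt (2 * ln (1 / \<delta>))\<close>.
\<close>
lemma std_normal_quantile_asymp:
  "((\<lambda>\<delta>. sqrt (2 * ln (2 / \<delta>)) / std_normal_quantile (1 - \<delta>)) \<longlongrightarrow> 1) (at_right 0)"
proof (rule tendsto_sandwich)
  let ?l = "\<lambda>\<delta>::real. sqrt (2 * ln (1 / (\<delta> * sqrt (2 * pi)))) - 1"
  have "filterlim ?l at_top (at_right 0)"
    by real_asymp
  then have ev: "\<forall>\<^sub>F \<delta> in at_right 0. 0 < ?l \<delta>"
    unfolding filterlim_at_top_dense by blast
  have small: "\<forall>\<^sub>F \<delta> in at_right (0::real). 0 < \<delta> \<and> \<delta> < 1 / 2"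
    by (auto simp: eventually_at_right_field intro!: exI[of _ "1/2"])
  show "\<forall>\<^sub>F \<delta> in at_right 0. sqrt (2 * ln (2 / \<delta>)) / sqrt (2 * ln (1 / \<delta>))
      \<le> sqrt (2 * ln (2 / \<delta>)) / std_normal_quantile (1 - \<delta>)"
    using small
  proof eventually_elim
    case (elim \<delta>)
    then show ?case
      using std_normal_quantile_bounds[of \<delta>] by (intro divide_left_mono) (auto simp: ln_ge_zero)
  qed
  show "\<forall>\<^sub>F \<delta> in at_right 0. sqrt (2 * ln (2 / \<delta>)) / std_normal_quantile (1 - \<delta>)
      \<le> sqrt (2 * ln (2 / \<delta>)) / ?l \<delta>"
    using small ev
  proof eventually_elim
    case (elim \<delta>)
    then show ?case
      using std_normal_quantile_bounds[of \<delta>] by (intro divide_left_mono) (auto simp: ln_ge_zero)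
  qed
  show "((\<lambda>\<delta>::real. sqrt (2 * ln (2 / \<delta>)) / sqrt (2 * ln (1 / \<delta>))) \<longlongrightarrow> 1) (at_right 0)"
    by real_asymp
  show "((\<lambda>\<delta>. sqrt (2 * ln (2 / \<delta>)) / ?l \<delta>) \<longlongrightarrow> 1) (at_right 0)"
    by real_asymp
qed

section \<open>Testing between two normal means\<close>

text \<open>
  Both sides agree on boxes, where Tonelli's theorem factorises the integral.
\<close>
lemma PiM_density:
  assumes "finite I" "product_sigma_finite M" "product_sigma_finite (\<lambda>i. density (M i) (p i))"
    and [measurable]: "\<And>i. i \<in> I \<Longrightarrow> p i \<in> borel_measurable (M i)"
  shows "PiM I (\<lambda>i. density (M i) (p i)) = density (PiM I M) (\<lambda>x. \<Prod>i\<in>I. p i (x i))"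
proof (rule sym, rule product_sigma_finite.PiM_eqI[OF assms(3)])
  interpret product_sigma_finite M by fact
  show "sets (density (PiM I M) (\<lambda>x. \<Prod>i\<in>I. p i (x i))) = sets (PiM I (\<lambda>i. density (M i) (p i)))"
    by (simp cong: sets_PiM_cong)
  fix A assume A: "\<And>i. i \<in> I \<Longrightarrow> A i \<in> sets (density (M i) (p i))"
  then have [measurable]: "A i \<in> sets (M i)" if "i \<in> I" for i
    using that by simp
  have "emeasure (density (PiM I M) (\<lambda>x. \<Prod>i\<in>I. p i (x i))) (Pi\<^sub>E I A)
      = (\<integral>\<^sup>+x. (\<Prod>i\<in>I. p i (x i)) * indicator (Pi\<^sub>E I A) x \<partial>PiM I M)"
    using assms(1) by (intro emeasure_density) (auto intro!: sets_PiM_I_finite)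
  also have "\<dots> = (\<integral>\<^sup>+x. (\<Prod>i\<in>I. p i (x i) * indicator (A i) (x i)) \<partial>PiM I M)"
  proof (rule nn_integral_cong)
    fix x assume "x \<in> space (PiM I M)"
    then have "x \<in> extensional I" by (simp add: space_PiM PiE_def)
    then have "indicator (Pi\<^sub>E I A) x = (\<Prod>i\<in>I. indicator (A i) (x i) :: ennreal)"
      using assms(1) by (auto simp: indicator_def PiE_def Pi_iff prod_zero_iff)
    then show "(\<Prod>i\<in>I. p i (x i)) * indicator (Pi\<^sub>E I A) x
        = (\<Prod>i\<in>I. p i (x i) * indicator (A i) (x i))"
      by (simp add: prod.distrib)
  qed
  also have "\<dots> = (\<Prod>i\<in>I. \<integral>\<^sup>+y. p i y * indicator (A i) y \<partial>M i)"
    using assms(1) by (intro product_nn_integral_prod) auto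
  also have "\<dots> = (\<Prod>i\<in>I. emeasure (density (M i) (p i)) (A i))"
    by (intro prod.cong refl) (simp add: emeasure_density)
  finally show "emeasure (density (PiM I M) (\<lambda>x. \<Prod>i\<in>I. p i (x i))) (Pi\<^sub>E I A)
      = (\<Prod>i\<in>I. emeasure (density (M i) (p i)) (A i))" .
qed fact

lemma product_sigma_finite_const:
  assumes "prob_space P"
  shows "product_sigma_finite (\<lambda>_. P)"
  using assms by (simp add: product_sigma_finite_def prob_space_imp_sigma_finite)

text \<open>
  The likelihood ratio of samples from the two shifted normal distributions depends on the sample
  only through its sum; for \<open>\<delta> > 0\<close> it exceeds 1 exactly where that sum is positive.
\<close>
lemma PiM_normal_dist_likelihood_ratio:
  fixes K :: nat
  shows "PiM {..<K} (\<lambda>_. normal_dist \<delta>)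
    = density (PiM {..<K} (\<lambda>_. normal_dist (- \<delta>))) (\<lambda>x. ennreal (exp (2 * \<delta> * (\<Sum>i<K. x i))))"
proof -
  have ratio: "normal_dist \<delta> = density (normal_dist (- \<delta>)) (\<lambda>x. ennreal (exp (2 * \<delta> * x)))"
  proof -
    have "density (normal_dist (- \<delta>)) (\<lambda>x. ennreal (exp (2 * \<delta> * x)))
        = density lborel (\<lambda>x. ennreal (normal_density (- \<delta>) 1 x) * ennreal (exp (2 * \<delta> * x)))"
      by (rule density_density_eq) auto
    also have "(\<lambda>x. ennreal (normal_density (- \<delta>) 1 x) * ennreal (exp (2 * \<delta> * x)))
        = (\<lambda>x. ennreal (normal_density \<delta> 1 x))"
    proof
      fix x
      have "exp (2 * \<delta> * x) * normal_density (- \<delta>) 1 x = normal_density \<delta> 1 x"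
        by (subst exp_times_normal_density) (simp add: power2_eq_square)
      then show "ennreal (normal_density (- \<delta>) 1 x) * ennreal (exp (2 * \<delta> * x))
          = ennreal (normal_density \<delta> 1 x)"
        by (simp add: ennreal_mult'[symmetric] mult.commute)
    qed
    finally show ?thesis by simp
  qed
  have "PiM {..<K} (\<lambda>_. normal_dist \<delta>)
      = PiM {..<K} (\<lambda>_. density (normal_dist (- \<delta>)) (\<lambda>x. ennreal (exp (2 * \<delta> * x))))"
    by (simp only: ratio[symmetric])
  also have "\<dots> = density (PiM {..<K} (\<lambda>_. normal_dist (- \<delta>)))
      (\<lambda>x. \<Prod>i<K. ennreal (exp (2 * \<delta> * x i)))"
  proof (rule PiM_density)
    show "product_sigma_finite (\<lambda>_::nat. normal_dist (- \<delta>))"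
      by (intro product_sigma_finite_const prob_space_normal_dist)
    show "product_sigma_finite
        (\<lambda>_::nat. density (normal_dist (- \<delta>)) (\<lambda>x. ennreal (exp (2 * \<delta> * x))))"
      unfolding ratio[symmetric] by (intro product_sigma_finite_const prob_space_normal_dist)
  qed auto
  also have "(\<lambda>x. \<Prod>i<K. ennreal (exp (2 * \<delta> * x i)))
      = (\<lambda>x. ennreal (exp (2 * \<delta> * (\<Sum>i<K. x i))))"
    by (rule ext) (subst prod_ennreal, simp, simp only: sum_distrib_left exp_sum finite_lessThan)
  finally show ?thesis .
qed

lemma distributed_sum_normal_sample:
  fixes K :: nat
  assumes "K \<ge> 1"
  shows "distributed (PiM {..<K} (\<lambda>_. normal_dist \<mu>)) lborel (\<lambda>x. \<Sum>i<K. x i)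
           (normal_density (real K * \<mu>) (sqrt (real K)))"
proof -
  let ?P = "PiM {..<K} (\<lambda>_. normal_dist \<mu>)"
  interpret prob_space ?P
    by (intro prob_space_PiM prob_space_normal_dist)
  have marg: "distr ?P (normal_dist \<mu>) (\<lambda>x. x i) = normal_dist \<mu>" if "i < K" for i
    using that by (intro distr_PiM_component) (auto intro: prob_space_normal_dist)
  have marg': "distr ?P borel (\<lambda>x. x i) = normal_dist \<mu>" if "i < K" for i
    using marg[OF that] by (metis (no_types, lifting) distr_cong sets_density sets_lborel)
  have ind: "indep_vars (\<lambda>_. borel) (\<lambda>i x. x i) {..<K}"
  proof (subst indep_vars_iff_distr_eq_PiM')
    show "{..<K} \<noteq> {}" using assms by (auto simp: lessThan_empty_iff)
    show "random_variable borel (\<lambda>x. x i)" if "i \<in> {..<K}" for i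
      using that by measurable
    have "distr ?P (PiM {..<K} (\<lambda>_. borel)) (\<lambda>x. \<lambda>i\<in>{..<K}. x i) = distr ?P ?P (\<lambda>x. x)"
    proof (rule distr_cong)
      show "sets (PiM {..<K} (\<lambda>_. borel)) = sets ?P"
        by (intro sets_PiM_cong) auto
      show "(\<lambda>i\<in>{..<K}. x i) = x" if "x \<in> space ?P" for x
        using that by (auto simp: space_PiM PiE_def extensional_restrict)
    qed simp
    also have "\<dots> = ?P" by (rule distr_id)
    also have "\<dots> = PiM {..<K} (\<lambda>i. distr ?P borel (\<lambda>x. x i))"
      by (intro PiM_cong) (simp_all add: marg')
    finally show "distr ?P (PiM {..<K} (\<lambda>_. borel)) (\<lambda>x. \<lambda>i\<in>{..<K}. x i)
        = PiM {..<K} (\<lambda>i. distr ?P borel (\<lambda>x. x i))" .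
  qed
  have "distributed ?P lborel (\<lambda>x. \<Sum>i\<in>{..<K}. x i)
      (normal_density (\<Sum>i\<in>{..<K}. \<mu>) (sqrt (\<Sum>i\<in>{..<K}. 1\<^sup>2)))"
  proof (rule sum_indep_normal[OF _ _ ind])
    fix i assume "i \<in> {..<K}"
    then show "distributed ?P lborel (\<lambda>x. x i) (normal_density \<mu> 1)"
      using marg'[of i] by (auto simp: distributed_def cong: distr_cong)
  qed (use assms in \<open>auto simp: lessThan_empty_iff\<close>)
  then show ?thesis by simp
qed

lemma prob_sum_normal_sample_nonpos:
  fixes K :: nat
  assumes "K \<ge> 1"
  shows "measure (PiM {..<K} (\<lambda>_. normal_dist \<mu>)) {x \<in> space (PiM {..<K} (\<lambda>_. normal_dist \<mu>)). (\<Sum>i<K. x i) \<le> 0}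
           = cdf std_normal_distribution (- (sqrt (real K) * \<mu>))"
proof -
  let ?P = "PiM {..<K} (\<lambda>_. normal_dist \<mu>)"
  let ?Z = "\<lambda>x. ((\<Sum>i<K. x i) - real K * \<mu>) / sqrt (real K)"
  interpret prob_space ?P
    by (intro prob_space_PiM prob_space_normal_dist)
  have K: "0 < sqrt (real K)" using assms by simp
  have "distributed ?P lborel ?Z std_normal_density"
    using distributed_sum_normal_sample[OF assms, of \<mu>]
    by (subst normal_standard_normal_convert[OF K, symmetric])
  then have Z: "distr ?P lborel ?Z = std_normal_distribution" "?Z \<in> measurable ?P lborel"
    by (auto simp: distributed_def)
  have "{x \<in> space ?P. (\<Sum>i<K. x i) \<le> 0} = ?Z -` {.. - (sqrt (real K) * \<mu>)} \<inter> space ?P"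
    using K by (auto simp: divide_le_eq algebra_simps simp flip: power2_eq_square)
  then show ?thesis
    unfolding cdf_def Z(1)[symmetric] using Z(2) by (simp add: measure_distr)
qed

text \<open>
  The Neyman-Pearson argument. The sets \<open>S\<close> and \<open>T\<close> are the events on which a decision rule errs
  under the means \<open>\<delta>\<close> and \<open>- \<delta>\<close>; they cover the space when some answer must be wrong at every
  sample point. Locally the smaller of the two product measures is the one of mean \<open>\<delta>\<close> where the sum
  of the sample is nonpositive, and the one of mean \<open>- \<delta>\<close> elsewhere. Replacing both measures by this
  minimum can only decrease the sum of the error probabilities, and the total mass of the minimum
  consists of two equal normal tails.
\<close>
lemma two_point_testing_bound:
  fixes K :: nat and \<delta> :: real
  defines "P \<equiv> \<lambda>m. PiM {..<K} (\<lambda>_. normal_dist m)"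
  assumes "K \<ge> 1" "0 \<le> \<delta>" and S: "S \<in> sets (P \<delta>)" and T: "T \<in> sets (P \<delta>)"
    and cover: "space (P \<delta>) \<subseteq> S \<union> T"
  shows "2 * (1 - cdf std_normal_distribution (sqrt (real K) * \<delta>))
    \<le> measure (P \<delta>) S + measure (P (- \<delta>)) T"
proof -
  have ps: "prob_space (P m)" for m
    unfolding P_def by (intro prob_space_PiM prob_space_normal_dist)
  interpret p: prob_space "P \<delta>" by (rule ps)
  interpret n: prob_space "P (- \<delta>)" by (rule ps)
  have sets: "sets (P m) = sets (P 0)" for m
    unfolding P_def by (intro sets_PiM_cong) auto
  have space: "space (P m) = space (P 0)" for m
    by (rule sets_eq_imp_space_eq[OF sets])
  define L where "L = {x \<in> space (P 0). (\<Sum>i<K. x i) \<le> 0}"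
  have sum_meas[measurable]: "(\<lambda>x. \<Sum>i<K. x i) \<in> borel_measurable (P m)" for m
    unfolding P_def by measurable
  have L: "L \<in> sets (P m)" for m
    unfolding L_def space[symmetric, of m] by measurable
  have S': "S \<in> sets (P m)" and T': "T \<in> sets (P m)" for m
    using S T sets by auto
  have ratio: "P \<delta> = density (P (- \<delta>)) (\<lambda>x. ennreal (exp (2 * \<delta> * (\<Sum>i<K. x i))))"
    unfolding P_def by (rule PiM_normal_dist_likelihood_ratio)
  have B: "B \<in> sets (P (- \<delta>))" if "B \<in> sets (P 0)" for B
    using that unfolding sets[of "- \<delta>"] .
  have em: "emeasure (P \<delta>) B
      = (\<integral>\<^sup>+x. ennreal (exp (2 * \<delta> * (\<Sum>i<K. x i))) * indicator B x \<partial>P (- \<delta>))"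
    if "B \<in> sets (P 0)" for B
    using B[OF that] by (subst ratio, subst emeasure_density) auto
  \<comment> \<open>On \<open>L\<close> the likelihood ratio is at most 1, off \<open>L\<close> it is at least 1.\<close>
  have le: "measure (P \<delta>) B \<le> measure (P (- \<delta>)) B" if "B \<in> sets (P 0)" "B \<subseteq> L" for B
  proof -
    have "emeasure (P \<delta>) B \<le> (\<integral>\<^sup>+x. indicator B x \<partial>P (- \<delta>))"
      unfolding em[OF that(1)]
    proof (rule nn_integral_mono)
      fix x
      have "exp (2 * \<delta> * (\<Sum>i<K. x i)) \<le> 1" if "x \<in> B"
        using that \<open>B \<subseteq> L\<close> assms(3) by (auto simp: L_def intro!: mult_nonneg_nonpos)
      then show "ennreal (exp (2 * \<delta> * (\<Sum>i<K. x i))) * indicator B x \<le> indicator B x"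
        by (auto simp: indicator_def)
    qed
    then show ?thesis
      using B[OF that(1)] by (simp only: nn_integral_indicator p.emeasure_eq_measure n.emeasure_eq_measure
          ennreal_le_iff measure_nonneg)
  qed
  have ge: "measure (P (- \<delta>)) B \<le> measure (P \<delta>) B" if "B \<in> sets (P 0)" "B \<inter> L = {}" for B
  proof -
    have "(\<integral>\<^sup>+x. indicator B x \<partial>P (- \<delta>)) \<le> emeasure (P \<delta>) B"
      unfolding em[OF that(1)]
    proof (rule nn_integral_mono)
      fix x assume "x \<in> space (P (- \<delta>))"
      then have "x \<in> space (P 0)" by (simp only: space[of "- \<delta>"])
      then have "0 < (\<Sum>i<K. x i)" if "x \<in> B"
        using that \<open>B \<inter> L = {}\<close> by (force simp: L_def)
      then have "1 \<le> exp (2 * \<delta> * (\<Sum>i<K. x i))" if "x \<in> B"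
        using that assms(3) by simp
      then show "indicator B x \<le> ennreal (exp (2 * \<delta> * (\<Sum>i<K. x i))) * indicator B x"
        by (auto simp: indicator_def)
    qed
    then show ?thesis
      using B[OF that(1)] by (simp only: nn_integral_indicator p.emeasure_eq_measure n.emeasure_eq_measure
          ennreal_le_iff measure_nonneg)
  qed
  have Lm: "measure (P m) L = cdf std_normal_distribution (- (sqrt (real K) * m))" for m
    unfolding L_def space[of m, symmetric] using prob_sum_normal_sample_nonpos[OF assms(2), of m]
    by (simp only: P_def)
  have inL: "S \<inter> L \<in> sets (P m)" "T \<inter> L \<in> sets (P m)" "S - L \<in> sets (P m)" "T - L \<in> sets (P m)" for m
    using S'[of m] T'[of m] L[of m] by auto
  have "L \<subseteq> S \<inter> L \<union> T \<inter> L"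
    using cover sets.sets_into_space[OF L[of \<delta>]] by blast
  then have "measure (P \<delta>) L \<le> measure (P \<delta>) (S \<inter> L \<union> T \<inter> L)"
    by (rule p.finite_measure_mono) (intro sets.Un inL)
  also have "\<dots> \<le> measure (P \<delta>) (S \<inter> L) + measure (P \<delta>) (T \<inter> L)"
    by (intro measure_Un_le inL)
  also have "measure (P \<delta>) (T \<inter> L) \<le> measure (P (- \<delta>)) (T \<inter> L)"
    by (intro le inL) blast
  finally have 1: "measure (P \<delta>) L \<le> measure (P \<delta>) (S \<inter> L) + measure (P (- \<delta>)) (T \<inter> L)"
    by simp
  have "space (P (- \<delta>)) - L \<subseteq> (S - L) \<union> (T - L)"
    using cover unfolding space[of \<delta>] space[of "- \<delta>"] by blast
  then have "measure (P (- \<delta>)) (space (P (- \<delta>)) - L) \<le> measure (P (- \<delta>)) ((S - L) \<union> (T - L))"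
    by (rule n.finite_measure_mono) (intro sets.Un inL)
  also have "\<dots> \<le> measure (P (- \<delta>)) (S - L) + measure (P (- \<delta>)) (T - L)"
    by (intro measure_Un_le inL)
  also have "measure (P (- \<delta>)) (S - L) \<le> measure (P \<delta>) (S - L)"
    by (intro ge inL) blast
  finally have 2: "1 - measure (P (- \<delta>)) L \<le> measure (P \<delta>) (S - L) + measure (P (- \<delta>)) (T - L)"
    by (simp only: n.prob_compl[OF L])
  have 3: "measure (P \<delta>) S = measure (P \<delta>) (S \<inter> L) + measure (P \<delta>) (S - L)"
    by (simp only: p.finite_measure_Diff'[OF S' L])
  have 4: "measure (P (- \<delta>)) T = measure (P (- \<delta>)) (T \<inter> L) + measure (P (- \<delta>)) (T - L)"
    by (simp only: n.finite_measure_Diff'[OF T' L])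
  have "measure (P \<delta>) L = 1 - cdf std_normal_distribution (sqrt (real K) * \<delta>)"
    by (simp only: Lm cdf_std_normal_minus)
  moreover have "measure (P (- \<delta>)) L = cdf std_normal_distribution (sqrt (real K) * \<delta>)"
    by (simp only: Lm mult_minus_right minus_minus)
  moreover have "measure (P \<delta>) L + (1 - measure (P (- \<delta>)) L)
      \<le> measure (P \<delta>) S + measure (P (- \<delta>)) T"
    unfolding 3 4 using add_mono[OF 1 2] by (simp only: ac_simps)
  ultimately show ?thesis
    by (simp only: mult_2)
qed

section \<open>Sub-Gaussian distributions\<close>

text \<open>
  Chernoff's bound for the sample mean in the direction \<open>f\<close>. The sub-Gaussian condition is applied
  to the vector \<open>s *\<^sub>R f\<close>, and independence turns the moment generating function of the sum into a
  power. The cases \<open>f = 0\<close> and \<open>L = 0\<close>, in which the optimal exponent degenerates, are trivial.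
\<close>
lemma sub_gaussian_sample_tail:
  fixes P :: "(real^'d) measure"
  assumes P: "P \<in> sub_gaussian \<theta> \<Theta>" and pd: "pos_def \<Theta>" and K: "K \<ge> 1" and L: "0 \<le> L"
  shows "measure (iid_sample K P) {\<omega> \<in> space (iid_sample K P).
      (1 / real K) * (\<Sum>i<K. f \<bullet> \<omega> i) - f \<bullet> \<theta> > sqrt (2 / real K * L * (f \<bullet> (\<Theta> *v f)))} \<le> exp (- L)"
proof (cases "f = 0 \<or> L = 0")
  case True
  have ps: "prob_space P" using P by (simp add: sub_gaussian_def)
  interpret prob_space "iid_sample K P" by (intro prob_space_PiM ps)
  from True show ?thesis
    using L prob_le_1 by auto
next
  case False
  define \<sigma>2 where "\<sigma>2 = f \<bullet> (\<Theta> *v f)"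
  have \<sigma>2: "0 < \<sigma>2" using pd False by (simp add: pos_def_def \<sigma>2_def)
  \<comment> \<open>\<open>s\<close> minimises \<open>real K * (s\<^sup>2 * \<sigma>2 / 2 - s * t)\<close>; the minimum is \<open>- L\<close>.\<close>
  define s where "s = sqrt (2 * L / (real K * \<sigma>2))"
  define t where "t = sqrt (2 / real K * L * \<sigma>2)"
  have s: "0 < s" using L False K \<sigma>2 by (simp add: s_def)
  have ps: "prob_space P" and sets: "sets P = sets borel"
    and mgf: "integrable P (\<lambda>\<zeta>. exp (h \<bullet> \<zeta>))"
      "ln (\<integral>\<zeta>. exp (h \<bullet> \<zeta>) \<partial>P) \<le> h \<bullet> \<theta> + (1/2) * (h \<bullet> (\<Theta> *v h))" for h
    using P by (auto simp: sub_gaussian_def)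
  interpret prob_space "iid_sample K P" by (intro prob_space_PiM ps)
  interpret P: prob_space P by (rule ps)
  interpret PP: product_sigma_finite "\<lambda>_::nat. P"
    by (simp add: product_sigma_finite_def P.sigma_finite_measure_axioms)
  let ?E = "\<lambda>\<omega>. exp (s * ((\<Sum>i<K. f \<bullet> \<omega> i) - real K * (f \<bullet> \<theta>)))"
  have E: "?E = (\<lambda>\<omega>. exp (- s * real K * (f \<bullet> \<theta>)) * (\<Prod>i<K. exp ((s *\<^sub>R f) \<bullet> \<omega> i)))"
    by (rule ext) (simp add: exp_sum[symmetric] sum_distrib_left right_diff_distrib flip: exp_add)
  have int: "integrable (iid_sample K P) ?E"
    unfolding E by (intro integrable_mult_right PP.product_integrable_prod mgf) auto
  have pos: "0 < (\<integral>\<zeta>. exp ((s *\<^sub>R f) \<bullet> \<zeta>) \<partial>P)"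
    using mgf(1)[of "s *\<^sub>R f"] sets
    by (intro P.expectation_greater) auto
  have one: "(\<integral>\<zeta>. exp ((s *\<^sub>R f) \<bullet> \<zeta>) \<partial>P) \<le> exp (s * (f \<bullet> \<theta>) + s\<^sup>2 * \<sigma>2 / 2)"
  proof -
    have "ln (\<integral>\<zeta>. exp ((s *\<^sub>R f) \<bullet> \<zeta>) \<partial>P) \<le> s * (f \<bullet> \<theta>) + s\<^sup>2 * \<sigma>2 / 2"
      using mgf(2)[of "s *\<^sub>R f"]
      by (simp add: \<sigma>2_def power2_eq_square matrix_vector_mult_scaleR)
    then show ?thesis using pos by (metis exp_le_cancel_iff exp_ln)
  qed
  have "expectation ?E = exp (- s * real K * (f \<bullet> \<theta>)) * (\<integral>\<zeta>. exp ((s *\<^sub>R f) \<bullet> \<zeta>) \<partial>P) ^ K"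
    unfolding E integral_mult_right_zero by (subst PP.product_integral_prod) (simp_all only: mgf finite_lessThan, simp)
  also have "\<dots> \<le> exp (- s * real K * (f \<bullet> \<theta>)) * exp (s * (f \<bullet> \<theta>) + s\<^sup>2 * \<sigma>2 / 2) ^ K"
    using pos one by (intro mult_left_mono power_mono) auto
  also have "\<dots> = exp (real K * (s\<^sup>2 * \<sigma>2 / 2))"
    by (simp add: exp_of_nat_mult[symmetric] algebra_simps flip: exp_add)
  also have "real K * (s\<^sup>2 * \<sigma>2 / 2) = L"
    using L K \<sigma>2 by (simp add: s_def field_simps)
  finally have expE: "expectation ?E \<le> exp L" .
  have st: "s * (real K * t) = 2 * L"
  proof -
    have "s * t = sqrt ((2 * L / real K)\<^sup>2)"
      unfolding s_def t_def real_sqrt_mult[symmetric] using \<sigma>2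
      by (simp add: power2_eq_square field_simps)
    also have "\<dots> = 2 * L / real K" using L by simp
    finally show ?thesis using K by (simp add: field_simps)
  qed
  have meas[measurable]: "(\<lambda>\<zeta>. f \<bullet> \<zeta>) \<in> borel_measurable P"
    unfolding measurable_cong_sets[OF sets refl] by measurable
  have "measure (iid_sample K P) {\<omega> \<in> space (iid_sample K P).
      (1 / real K) * (\<Sum>i<K. f \<bullet> \<omega> i) - f \<bullet> \<theta> > t}
    \<le> measure (iid_sample K P) {\<omega> \<in> space (iid_sample K P). exp (s * (real K * t)) \<le> ?E \<omega>}"
  proof (rule finite_measure_mono)
    have "exp (s * (real K * t)) \<le> ?E \<omega>"
      if "(1 / real K) * (\<Sum>i<K. f \<bullet> \<omega> i) - f \<bullet> \<theta> > t" for \<omega>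
    proof -
      have "real K * t \<le> (\<Sum>i<K. f \<bullet> \<omega> i) - real K * (f \<bullet> \<theta>)"
        using that K by (simp add: field_simps)
      then show ?thesis using s by simp
    qed
    then show "{\<omega> \<in> space (iid_sample K P). (1 / real K) * (\<Sum>i<K. f \<bullet> \<omega> i) - f \<bullet> \<theta> > t}
      \<subseteq> {\<omega> \<in> space (iid_sample K P). exp (s * (real K * t)) \<le> ?E \<omega>}"
      by blast
    show "{\<omega> \<in> space (iid_sample K P). exp (s * (real K * t)) \<le> ?E \<omega>} \<in> events"
      by measurable
  qed
  also have "\<dots> \<le> expectation ?E / exp (s * (real K * t))"
    using int by (intro integral_Markov_inequality_measure[where A = "{}"]) auto
  also have "\<dots> \<le> exp L / exp (2 * L)"
    unfolding st using expE by (intro divide_right_mono) auto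
  also have "\<dots> = exp (- L)"
    by (simp flip: exp_diff)
  finally show ?thesis
    by (simp add: t_def \<sigma>2_def)
qed

text \<open>
  A normal distribution carried by a line. Its moment generating function has the quadratic term
  \<open>(f \<bullet> z)\<^sup>2\<close>, so domination of that term by \<open>\<Theta>\<close> is all that membership in the sub-Gaussian family
  requires. The lower bound uses these distributions because testing between two of them on the same
  line is a problem about real normal variables.
\<close>
lemma line_gaussian_sub_gaussian:
  fixes z b :: "real^'d"
  assumes z: "\<And>f. (f \<bullet> z)\<^sup>2 \<le> f \<bullet> (\<Theta> *v f)"
  shows "distr (normal_dist \<delta>) borel (\<lambda>x. b + x *\<^sub>R z) \<in> sub_gaussian (b + \<delta> *\<^sub>R z) \<Theta>"
proof -
  interpret prob_space "normal_dist \<delta>" by (rule prob_space_normal_dist)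
  have [measurable]: "(\<lambda>x. b + x *\<^sub>R z) \<in> borel_measurable (normal_dist \<delta>)"
    by simp
  have eq: "exp (f \<bullet> (b + x *\<^sub>R z)) = exp (f \<bullet> b) * exp ((f \<bullet> z) * x)" for f x
    by (simp add: inner_add_right mult.commute flip: exp_add)
  have int: "integrable (distr (normal_dist \<delta>) borel (\<lambda>x. b + x *\<^sub>R z)) (\<lambda>\<zeta>. exp (f \<bullet> \<zeta>))" for f
    by (subst integrable_distr_eq) (simp_all only: eq, auto intro!: integrable_mult_right normal_dist_mgf(1))
  have "(\<integral>\<zeta>. exp (f \<bullet> \<zeta>) \<partial>distr (normal_dist \<delta>) borel (\<lambda>x. b + x *\<^sub>R z))
      = exp (f \<bullet> (b + \<delta> *\<^sub>R z) + (f \<bullet> z)\<^sup>2 / 2)" for f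
  proof -
    have "(\<integral>\<zeta>. exp (f \<bullet> \<zeta>) \<partial>distr (normal_dist \<delta>) borel (\<lambda>x. b + x *\<^sub>R z))
        = (\<integral>x. exp (f \<bullet> b) * exp ((f \<bullet> z) * x) \<partial>normal_dist \<delta>)"
      by (subst integral_distr) (simp_all only: eq, simp_all)
    also have "\<dots> = exp (f \<bullet> b) * exp ((f \<bullet> z) * \<delta> + (f \<bullet> z)\<^sup>2 / 2)"
      by (simp only: integral_mult_right_zero normal_dist_mgf(2))
    finally show ?thesis
      by (simp add: inner_add_right mult.commute flip: exp_add)
  qed
  then have "ln (\<integral>\<zeta>. exp (f \<bullet> \<zeta>) \<partial>distr (normal_dist \<delta>) borel (\<lambda>x. b + x *\<^sub>R z))
      \<le> f \<bullet> (b + \<delta> *\<^sub>R z) + (1/2) * (f \<bullet> (\<Theta> *v f))" for f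
    using z[of f] by simp
  with int show ?thesis
    by (simp add: sub_gaussian_def prob_space_distr)
qed

lemma iid_sample_distr:
  assumes "prob_space N" and F: "F \<in> measurable N B"
  shows "iid_sample K (distr N B F) = distr (iid_sample K N) (iid_sample K B) (compose {..<K} F)"
    and "compose {..<K} F \<in> measurable (iid_sample K N) (iid_sample K B)"
proof -
  let ?P = "distr N B F"
  have P: "prob_space ?P" using assms by (rule prob_space.prob_space_distr)
  have FP: "F \<in> measurable N ?P" using F by simp
  have sets: "sets (iid_sample K ?P) = sets (iid_sample K B)"
    by (intro sets_PiM_cong) auto
  have "distr (iid_sample K N) (iid_sample K ?P) (compose {..<K} F) = iid_sample K (distr N ?P F)"
    by (rule distr_PiM_finite_prob_space') (use assms(1) P FP in auto)
  also have "distr N ?P F = ?P" by (rule distr_cong) auto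
  also have "distr (iid_sample K N) (iid_sample K ?P) (compose {..<K} F)
      = distr (iid_sample K N) (iid_sample K B) (compose {..<K} F)"
    using sets by (intro distr_cong) auto
  finally show "iid_sample K ?P = distr (iid_sample K N) (iid_sample K B) (compose {..<K} F)" by simp
  show "compose {..<K} F \<in> measurable (iid_sample K N) (iid_sample K B)"
    unfolding compose_def using F by measurable
qed

section \<open>The optimization problem and its dual\<close>

lemma pos_def_cauchy_schwarz:
  assumes "pos_def \<Theta>"
  shows "(h \<bullet> (\<Theta> *v f))\<^sup>2 \<le> (h \<bullet> (\<Theta> *v h)) * (f \<bullet> (\<Theta> *v f))"
proof (cases "f = 0")
  case False
  define t where "t = (h \<bullet> (\<Theta> *v f)) / (f \<bullet> (\<Theta> *v f))"
  have ff: "0 < f \<bullet> (\<Theta> *v f)" using assms False by (simp add: pos_def_def)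
  have sym: "f \<bullet> (\<Theta> *v h) = h \<bullet> (\<Theta> *v f)"
    using assms by (metis dot_lmul_matrix inner_commute pos_def_def vector_transpose_matrix)
  have "0 \<le> (h - t *\<^sub>R f) \<bullet> (\<Theta> *v (h - t *\<^sub>R f))"
    using assms by (cases "h - t *\<^sub>R f = 0") (auto simp: pos_def_def intro: less_imp_le)
  also have "\<dots> = h \<bullet> (\<Theta> *v h) - 2 * t * (h \<bullet> (\<Theta> *v f)) + t\<^sup>2 * (f \<bullet> (\<Theta> *v f))"
    by (simp add: matrix_vector_mult_diff_distrib matrix_vector_mult_scaleR inner_diff_left
        inner_diff_right sym power2_eq_square algebra_simps)
  also have "\<dots> = h \<bullet> (\<Theta> *v h) - (h \<bullet> (\<Theta> *v f))\<^sup>2 / (f \<bullet> (\<Theta> *v f))"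
    using ff by (simp add: t_def power2_eq_square field_simps)
  finally show ?thesis using ff by (simp add: field_simps)
qed simp

text \<open>
  The constant is the least value of the quadratic form on the unit sphere, attained by compactness.
\<close>
lemma pos_def_coercive:
  fixes \<Theta> :: "real^'d^'d"
  assumes "pos_def \<Theta>"
  shows "\<exists>r>0. \<forall>f. r * (norm f)\<^sup>2 \<le> f \<bullet> (\<Theta> *v f)"
proof -
  have "\<exists>x\<in>sphere 0 1. \<forall>y\<in>sphere (0::real^'d) 1. x \<bullet> (\<Theta> *v x) \<le> y \<bullet> (\<Theta> *v y)"
    by (rule continuous_attains_inf)
       (auto intro!: continuous_on_inner continuous_on_id matrix_vector_mult_linear_continuous_on
         simp: sphere_eq_empty)
  then obtain x where x: "norm x = 1"
    "\<And>y. norm y = 1 \<Longrightarrow> x \<bullet> (\<Theta> *v x) \<le> y \<bullet> (\<Theta> *v y)"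
    by auto
  have "x \<bullet> (\<Theta> *v x) * (norm f)\<^sup>2 \<le> f \<bullet> (\<Theta> *v f)" for f
  proof (cases "f = 0")
    case False
    have "x \<bullet> (\<Theta> *v x) * (norm f)\<^sup>2
        \<le> ((inverse (norm f) *\<^sub>R f) \<bullet> (\<Theta> *v (inverse (norm f) *\<^sub>R f))) * (norm f)\<^sup>2"
      using False by (intro mult_right_mono x(2)) auto
    also have "\<dots> = f \<bullet> (\<Theta> *v f)"
      using False by (simp add: matrix_vector_mult_scaleR power2_eq_square field_simps)
    finally show ?thesis .
  qed simp
  moreover have "x \<noteq> 0" using x(1) by auto
  then have "0 < x \<bullet> (\<Theta> *v x)"
    using assms by (simp add: pos_def_def)
  ultimately show ?thesis by blast
qed

lemma support_fun_upper:
  assumes "compact U" "u \<in> U"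
  shows "u \<bullet> h \<le> support_fun U h"
  unfolding support_fun_def using assms
  by (intro cSUP_upper bounded_imp_bdd_above compact_imp_bounded compact_continuous_image
      continuous_intros)

lemma support_fun_attained:
  assumes "compact U" "U \<noteq> {}"
  obtains u where "u \<in> U" "support_fun U h = u \<bullet> h"
proof -
  have "\<exists>u\<in>U. \<forall>y\<in>U. y \<bullet> h \<le> u \<bullet> h"
    using assms by (intro continuous_attains_sup continuous_intros)
  then obtain u where u: "u \<in> U" "\<And>y. y \<in> U \<Longrightarrow> y \<bullet> h \<le> u \<bullet> h" by blast
  have "support_fun U h = u \<bullet> h"
    unfolding support_fun_def using u by (intro cSup_eq_maximum) auto
  with u(1) show ?thesis by (rule that)
qed

text \<open>
  For a positive definite \<open>M v\<close> the inequality says \<open>z \<bullet> (matrix_inv (M v) *v z) \<le> 1\<close>, or equivalently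
  that \<open>M v\<close> dominates the rank-one matrix of \<open>z\<close>. In this form it is an intersection of sublevel
  sets of functions that are convex in \<open>(z, v)\<close> jointly, and it is exactly the condition under which
  a normal variable multiplied by \<open>z\<close> is sub-Gaussian with matrix \<open>M v\<close>. The parameter \<open>v\<close> is kept as
  a component to make compactness and convexity easy to see.
\<close>
definition noise_directions :: "(real^'m) set \<Rightarrow> (real^'m \<Rightarrow> real^'d^'d) \<Rightarrow> ((real^'d) \<times> (real^'m)) set" where
  "noise_directions V M = {(z, v). v \<in> V \<and> (\<forall>f. (f \<bullet> z)\<^sup>2 \<le> f \<bullet> (M v *v f))}"

locale recovery_problem =
  fixes U :: "(real^'n) set" and V :: "(real^'m) set"
    and A :: "real^'n^'d" and g :: "real^'n"
    and M :: "real^'m \<Rightarrow> real^'d^'d"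
    and K :: nat and \<epsilon> :: real
  assumes K: "K \<ge> 1" and \<epsilon>: "0 < \<epsilon>" "\<epsilon> < 1/2"
    and U: "U \<noteq> {}" "convex U" "compact U"
    and V: "V \<noteq> {}" "convex V" "compact V"
    and affine: "affine_map M"
    and pd: "\<And>v. v \<in> V \<Longrightarrow> pos_def (M v)"
begin

definition noise_scale :: real where
  "noise_scale = sqrt (2 / real K * ln (2 / \<epsilon>))"

abbreviation objective :: "real^'d \<Rightarrow> real" where
  "objective \<equiv> est_objective U V A g M K \<epsilon>"

lemma noise_scale_pos: "0 < noise_scale"
  using K \<epsilon> by (simp add: noise_scale_def)

lemma sqrt_noise_scale:
  "sqrt (2 / real K * ln (2 / \<epsilon>) * q) = noise_scale * sqrt q"
  by (simp only: noise_scale_def real_sqrt_mult)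

lemma quadratic_form_affine:
  "\<exists>l b. linear l \<and> (\<forall>v. f \<bullet> (M v *v f) = l v + b)"
proof -
  obtain L C where L: "linear L" "\<And>v. M v = L v + C"
    using affine by (auto simp: affine_map_def)
  have "linear (\<lambda>v. f \<bullet> (L v *v f))"
    by (rule linearI)
       (simp_all add: linear_add[OF L(1)] linear_scale[OF L(1)] matrix_vector_mult_add_rdistrib
         inner_add_right scaleR_matrix_vector_assoc[symmetric])
  moreover have "f \<bullet> (M v *v f) = f \<bullet> (L v *v f) + f \<bullet> (C *v f)" for v
    by (simp add: L(2) matrix_vector_mult_add_rdistrib inner_add_right)
  ultimately show ?thesis by blast
qed

lemma continuous_on_quadratic_form: "continuous_on S (\<lambda>v. f \<bullet> (M v *v f))"
proof -
  obtain l b where l: "linear l" "\<And>v. f \<bullet> (M v *v f) = l v + b"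
    using quadratic_form_affine[of f] by blast
  show ?thesis
    unfolding l(2) using l(1)
    by (intro continuous_intros linear_continuous_on) (simp add: linear_conv_bounded_linear)
qed

lemma noise_directions_eq_Inter:
  "noise_directions V M = (UNIV \<times> V) \<inter> (\<Inter>f. {x. (f \<bullet> fst x)\<^sup>2 - f \<bullet> (M (snd x) *v f) \<le> 0})"
  by (auto simp: noise_directions_def)

text \<open>
  Each defining inequality bounds a convex quadratic in \<open>z\<close> by an affine function of \<open>v\<close>.
\<close>
lemma convex_noise_directions: "convex (noise_directions V M)"
  unfolding noise_directions_eq_Inter
proof (intro convex_Int convex_INT convex_Times convex_UNIV V)
  fix f :: "real^'d"
  obtain l b where l: "linear l" "\<And>v. f \<bullet> (M v *v f) = l v + b"
    using quadratic_form_affine[of f] by blast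
  show "convex {x. (f \<bullet> fst x)\<^sup>2 - f \<bullet> (M (snd x) *v f) \<le> 0}"
  proof (rule convexI, clarify)
    fix z v z' v' s t
    assume *: "(f \<bullet> fst (z, v))\<^sup>2 - f \<bullet> (M (snd (z, v)) *v f) \<le> 0"
      "(f \<bullet> fst (z', v'))\<^sup>2 - f \<bullet> (M (snd (z', v')) *v f) \<le> 0"
      and st: "0 \<le> s" "0 \<le> t" "s + t = (1::real)"
    have "(s * (f \<bullet> z) + t * (f \<bullet> z'))\<^sup>2 \<le> s * (f \<bullet> z)\<^sup>2 + t * (f \<bullet> z')\<^sup>2"
    proof -
      have "s * (f \<bullet> z)\<^sup>2 + t * (f \<bullet> z')\<^sup>2 - (s * (f \<bullet> z) + t * (f \<bullet> z'))\<^sup>2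
          = s * t * (f \<bullet> z - f \<bullet> z')\<^sup>2"
        using st(3) by algebra
      moreover have "0 \<le> s * t * (f \<bullet> z - f \<bullet> z')\<^sup>2" using st by simp
      ultimately show ?thesis by linarith
    qed
    also have "\<dots> \<le> s * (l v + b) + t * (l v' + b)"
      using * st by (intro add_mono mult_left_mono) (auto simp: l(2))
    also have "\<dots> = l (s *\<^sub>R v + t *\<^sub>R v') + b * (s + t)"
      by (simp add: linear_add[OF l(1)] linear_scale[OF l(1)] algebra_simps)
    finally show "(f \<bullet> fst (s *\<^sub>R (z, v) + t *\<^sub>R (z', v')))\<^sup>2
        - f \<bullet> (M (snd (s *\<^sub>R (z, v) + t *\<^sub>R (z', v'))) *v f) \<le> 0"
      using st(3) by (simp add: l(2) inner_add_right)
  qed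
qed

text \<open>
  Boundedness: with \<open>f\<close> a coordinate vector, the inequality bounds that coordinate of \<open>z\<close> by a
  diagonal entry of \<open>M v\<close>, which is bounded for \<open>v\<close> in the compact set \<open>V\<close>.
\<close>
lemma compact_noise_directions: "compact (noise_directions V M)"
proof -
  have closed: "closed (noise_directions V M)"
    unfolding noise_directions_eq_Inter
  proof (intro closed_Int closed_INT closed_Times closed_UNIV compact_imp_closed[OF V(3)] ballI)
    fix f :: "real^'d"
    have cont: "continuous_on UNIV (\<lambda>x :: (real^'d) \<times> (real^'m). f \<bullet> (M (snd x) *v f))"
      using continuous_on_compose[OF continuous_on_snd[OF continuous_on_id] continuous_on_quadratic_form, of UNIV f]
      by (simp add: o_def)
    have "continuous_on UNIV (\<lambda>x :: (real^'d) \<times> (real^'m). (f \<bullet> fst x)\<^sup>2 - f \<bullet> (M (snd x) *v f))"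
      by (intro continuous_on_diff cont continuous_intros)
    then show "closed {x :: (real^'d) \<times> (real^'m). (f \<bullet> fst x)\<^sup>2 - f \<bullet> (M (snd x) *v f) \<le> 0}"
      by (rule closed_Collect_le) (rule continuous_on_const)
  qed
  have "\<exists>B. \<forall>v\<in>V. axis i 1 \<bullet> (M v *v axis i 1) \<le> B" for i
    using compact_imp_bounded[OF compact_continuous_image[OF continuous_on_quadratic_form V(3)],
        THEN bounded_imp_bdd_above]
    by (auto simp: bdd_above_def)
  then obtain B where B: "\<And>i v. v \<in> V \<Longrightarrow> axis i 1 \<bullet> (M v *v axis i 1) \<le> B i" by metis
  have "bounded (fst ` noise_directions V M)"
    unfolding bounded_iff
  proof (intro exI ballI)
    fix z assume "z \<in> fst ` noise_directions V M"
    then obtain v where v: "v \<in> V" "\<And>f. (f \<bullet> z)\<^sup>2 \<le> f \<bullet> (M v *v f)"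
      by (auto simp: noise_directions_def)
    have "\<bar>z $ i\<bar> \<le> B i + 1" for i
    proof -
      have "2 * \<bar>z $ i\<bar> \<le> (z $ i)\<^sup>2 + 1"
        using zero_le_power2[of "\<bar>z $ i\<bar> - 1"] by (simp add: power2_diff)
      moreover have "(z $ i)\<^sup>2 \<le> B i"
        using v(2)[of "axis i 1"] B[OF v(1), of i] by (simp add: inner_axis inner_commute)
      moreover have "0 \<le> B i"
        using \<open>(z $ i)\<^sup>2 \<le> B i\<close> order_trans[OF zero_le_power2] by blast
      ultimately show ?thesis by simp
    qed
    then show "norm z \<le> (\<Sum>i\<in>UNIV. B i + 1)"
      by (intro order_trans[OF norm_le_l1_cart] sum_mono)
  qed
  moreover have "noise_directions V M \<subseteq> fst ` noise_directions V M \<times> V"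
    by (force simp: noise_directions_def)
  ultimately have "bounded (noise_directions V M)"
    using bounded_subset bounded_Times compact_imp_bounded[OF V(3)] by metis
  with closed show ?thesis by (simp add: compact_eq_bounded_closed)
qed

lemma quadratic_form_nonneg:
  assumes "v \<in> V"
  shows "0 \<le> f \<bullet> (M v *v f)"
  using pd[OF assms] by (cases "f = 0") (auto simp: pos_def_def less_imp_le)

lemma zero_noise_direction: "v \<in> V \<Longrightarrow> (0, v) \<in> noise_directions V M"
  by (simp add: noise_directions_def quadratic_form_nonneg)

text \<open>
  The slices of the set of noise directions have \<open>\<lambda>f. sqrt (f \<bullet> (M v *v f))\<close> as their support
  function; the maximiser is the gradient of that function at \<open>f\<close>, and it is
  admissible by the Cauchy-Schwarz inequality for \<open>M v\<close>.
\<close>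
lemma noise_direction_attains:
  assumes "v \<in> V"
  obtains z where "(z, v) \<in> noise_directions V M" "f \<bullet> z = sqrt (f \<bullet> (M v *v f))"
proof (cases "f = 0")
  case True
  then show ?thesis using that[OF zero_noise_direction[OF assms]] by simp
next
  case False
  let ?q = "f \<bullet> (M v *v f)"
  let ?z = "(1 / sqrt ?q) *\<^sub>R (M v *v f)"
  have q: "0 < ?q" using pd[OF assms] False by (simp add: pos_def_def)
  have "(h \<bullet> ?z)\<^sup>2 \<le> h \<bullet> (M v *v h)" for h
    using pos_def_cauchy_schwarz[OF pd[OF assms], of h f] q
    by (simp add: power_divide divide_le_eq)
  then have "(?z, v) \<in> noise_directions V M"
    using assms by (simp add: noise_directions_def)
  moreover have "f \<bullet> ?z = sqrt ?q"
    using q by (simp add: real_div_sqrt)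
  ultimately show ?thesis by (rule that)
qed

text \<open>
  This lemma and the next one present the objective as a maximum, over a compact convex set of
  parameters, of functions affine in \<open>f\<close> and affine in the parameters. Convexity in \<open>f\<close> and the
  duality argument below rest on this form alone.
\<close>
lemma objective_upper:
  assumes "u \<in> U" "u' \<in> U" "(z, v) \<in> noise_directions V M"
  shows "(1/2) * ((u - u') \<bullet> (transpose A *v f - g)) + noise_scale * (f \<bullet> z) \<le> objective f"
proof -
  have v: "v \<in> V" and z: "(f \<bullet> z)\<^sup>2 \<le> f \<bullet> (M v *v f)"
    using assms(3) by (auto simp: noise_directions_def)
  have "f \<bullet> z \<le> sqrt (f \<bullet> (M v *v f))"
    using z by (rule real_le_rsqrt)
  then have "noise_scale * (f \<bullet> z) \<le> noise_scale * sqrt (f \<bullet> (M v *v f))"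
    using noise_scale_pos by simp
  also have "\<dots> \<le> (SUP v\<in>V. noise_scale * sqrt (f \<bullet> (M v *v f)))"
    using v V(3)
    by (intro cSUP_upper bounded_imp_bdd_above compact_imp_bounded compact_continuous_image
        continuous_intros continuous_on_quadratic_form)
  finally have 1: "noise_scale * (f \<bullet> z) \<le> (SUP v\<in>V. noise_scale * sqrt (f \<bullet> (M v *v f)))" .
  show ?thesis
    unfolding est_objective_def sqrt_noise_scale
    using 1 support_fun_upper[OF U(3) assms(1), of "transpose A *v f - g"]
      support_fun_upper[OF U(3) assms(2), of "- (transpose A *v f) + g"]
    by (simp add: algebra_simps inner_diff_left inner_diff_right inner_add_right)
qed

lemma objective_attained:
  obtains u u' z v where "u \<in> U" "u' \<in> U" "(z, v) \<in> noise_directions V M"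
    "objective f = (1/2) * ((u - u') \<bullet> (transpose A *v f - g)) + noise_scale * (f \<bullet> z)"
proof -
  obtain u where u: "u \<in> U" "support_fun U (transpose A *v f - g) = u \<bullet> (transpose A *v f - g)"
    using support_fun_attained[OF U(3,1)] .
  obtain u' where u': "u' \<in> U"
      "support_fun U (- (transpose A *v f) + g) = u' \<bullet> (- (transpose A *v f) + g)"
    using support_fun_attained[OF U(3,1)] .
  have "\<exists>v\<in>V. \<forall>y\<in>V. noise_scale * sqrt (f \<bullet> (M y *v f)) \<le> noise_scale * sqrt (f \<bullet> (M v *v f))"
    using V by (intro continuous_attains_sup continuous_intros continuous_on_quadratic_form)
  then obtain v where v: "v \<in> V"
    "\<And>y. y \<in> V \<Longrightarrow> noise_scale * sqrt (f \<bullet> (M y *v f)) \<le> noise_scale * sqrt (f \<bullet> (M v *v f))"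
    by blast
  have sup: "(SUP v\<in>V. noise_scale * sqrt (f \<bullet> (M v *v f))) = noise_scale * sqrt (f \<bullet> (M v *v f))"
    using v by (intro cSup_eq_maximum) auto
  obtain z where z: "(z, v) \<in> noise_directions V M" "f \<bullet> z = sqrt (f \<bullet> (M v *v f))"
    using noise_direction_attains[OF v(1)] .
  show ?thesis
  proof (rule that[OF u(1) u'(1) z(1)])
    show "objective f = (1/2) * ((u - u') \<bullet> (transpose A *v f - g)) + noise_scale * (f \<bullet> z)"
      unfolding est_objective_def sqrt_noise_scale sup u u' z
      by (simp add: algebra_simps inner_diff_left inner_diff_right inner_add_right)
  qed
qed

lemma convex_on_objective: "convex_on UNIV objective"
proof (rule convex_onI)
  fix t :: real and x y :: "real^'d"
  assume t: "0 < t" "t < 1"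
  let ?p = "(1 - t) *\<^sub>R x + t *\<^sub>R y"
  obtain u u' z v where w: "u \<in> U" "u' \<in> U" "(z, v) \<in> noise_directions V M"
    and eq: "objective ?p = (1/2) * ((u - u') \<bullet> (transpose A *v ?p - g)) + noise_scale * (?p \<bullet> z)"
    by (rule objective_attained)
  have p: "transpose A *v ?p - g
      = (1 - t) *\<^sub>R (transpose A *v x - g) + t *\<^sub>R (transpose A *v y - g)"
    by (simp add: matrix_vector_right_distrib matrix_vector_mult_scaleR) (simp add: algebra_simps)
  note eq
  also have "(1/2) * ((u - u') \<bullet> (transpose A *v ?p - g)) + noise_scale * (?p \<bullet> z)
      = (1 - t) * ((1/2) * ((u - u') \<bullet> (transpose A *v x - g)) + noise_scale * (x \<bullet> z))
      + t * ((1/2) * ((u - u') \<bullet> (transpose A *v y - g)) + noise_scale * (y \<bullet> z))"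
    unfolding p inner_add_right inner_add_left inner_scaleR_right inner_scaleR_left
    by (simp only: distrib_left mult.left_commute add_ac)
  also have "\<dots> \<le> (1 - t) * objective x + t * objective y"
    using t w by (intro add_mono mult_left_mono objective_upper) auto
  finally show "objective ?p \<le> (1 - t) * objective x + t * objective y" .
qed simp

lemma objective_ge_noise:
  assumes "v \<in> V"
  shows "noise_scale * sqrt (f \<bullet> (M v *v f)) \<le> objective f"
proof -
  obtain z where z: "(z, v) \<in> noise_directions V M" "f \<bullet> z = sqrt (f \<bullet> (M v *v f))"
    using noise_direction_attains[OF assms] .
  obtain u where "u \<in> U" using U by auto
  then show ?thesis
    using objective_upper[OF _ _ z(1), of u u f] z(2) by simp
qed

lemma objective_nonneg: "0 \<le> objective f"
proof -
  obtain v where v: "v \<in> V" using V by auto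
  have "0 \<le> noise_scale * sqrt (f \<bullet> (M v *v f))"
    using noise_scale_pos quadratic_form_nonneg[OF v] by simp
  also have "\<dots> \<le> objective f" by (rule objective_ge_noise[OF v])
  finally show ?thesis .
qed

text \<open>
  The objective is convex, hence continuous, and it grows at least linearly because its noise term
  dominates a multiple of the norm.
\<close>
lemma objective_attains_min: "\<exists>f. \<forall>h. objective f \<le> objective h"
proof -
  obtain v where v: "v \<in> V" using V by auto
  obtain r where r: "0 < r" "\<And>f. r * (norm f)\<^sup>2 \<le> f \<bullet> (M v *v f)"
    using pos_def_coercive[OF pd[OF v]] by auto
  define R where "R = objective 0 / (noise_scale * sqrt r)"
  have pos: "0 < noise_scale * sqrt r" using noise_scale_pos r by simp
  have R: "0 \<le> R" using pos objective_nonneg by (simp add: R_def)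
  have "continuous_on (cball 0 R) objective"
    using convex_on_continuous[OF open_UNIV convex_on_objective] continuous_on_subset by blast
  then have "\<exists>f\<in>cball 0 R. \<forall>h\<in>cball 0 R. objective f \<le> objective h"
    using R by (intro continuous_attains_inf) auto
  then obtain f where f: "\<And>h. norm h \<le> R \<Longrightarrow> objective f \<le> objective h"
    unfolding mem_cball_0[symmetric] by blast
  have "objective f \<le> objective h" for h
  proof (cases "norm h \<le> R")
    case False
    have "objective f \<le> objective 0" using f[of 0] R by simp
    also have "\<dots> = noise_scale * sqrt r * R" using noise_scale_pos r(1) by (simp add: R_def)
    also have "\<dots> \<le> noise_scale * sqrt r * norm h"
      using False pos by (intro mult_left_mono) auto
    also have "\<dots> = noise_scale * sqrt (r * (norm h)\<^sup>2)"
      by (simp add: real_sqrt_mult)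
    also have "\<dots> \<le> noise_scale * sqrt (h \<bullet> (M v *v h))"
      using noise_scale_pos r(2) by simp
    also have "\<dots> \<le> objective h" by (rule objective_ge_noise[OF v])
    finally show ?thesis .
  qed (rule f)
  then show ?thesis by blast
qed

lemma est_opt_eq_min:
  assumes "\<And>h. objective f \<le> objective h"
  shows "est_opt U V A g M K \<epsilon> = objective f"
  unfolding est_opt_def using assms by (intro cInf_eq_minimum) auto

text \<open>
  The duality step. If the conclusion fails, then the compact convex set of all pairs
  \<open>(A *v (u' - u) - (2 * noise_scale) *\<^sub>R z, (1/2) * (g \<bullet> (u' - u)))\<close> does not meet the closed ray of
  the points \<open>(0, t)\<close> with \<open>t \<ge> opt\<close>, and a hyperplane separates the two strictly. Its last coefficient
  \<open>s\<close> is positive, since the set contains the origin; up to scaling, its first component \<open>p\<close> is a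
  vector \<open>f\<close> at which the objective is below \<open>opt\<close>.
\<close>
lemma worst_case_pair:
  assumes opt: "\<And>f. opt \<le> objective f"
  obtains u u' z v where "u \<in> U" "u' \<in> U" "(z, v) \<in> noise_directions V M"
    "A *v (u' - u) = (2 * noise_scale) *\<^sub>R z" "opt \<le> (1/2) * (g \<bullet> (u' - u))"
proof -
  define X where "X = (U \<times> U) \<times> noise_directions V M"
  define T where "T = (\<lambda>x :: (((real^'n) \<times> (real^'n)) \<times> ((real^'d) \<times> (real^'m))).
    (A *v (snd (fst x) - fst (fst x)) - (2 * noise_scale) *\<^sub>R fst (snd x),
     (1/2) * (g \<bullet> (snd (fst x) - fst (fst x)))))"
  have T: "linear T"
  proof (rule linearI)
    show "T (x + y) = T x + T y" for x y
      by (simp add: T_def matrix_vector_right_distrib matrix_vector_mult_diff_distrib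
          inner_add_right inner_diff_right scaleR_add_right field_simps)
    show "T (r *\<^sub>R x) = r *\<^sub>R T x" for r x
      by (simp add: T_def matrix_vector_mult_diff_distrib matrix_vector_mult_scaleR
          inner_diff_right scaleR_diff_right field_simps)
  qed
  have X: "convex X" "compact X"
    unfolding X_def using U V
    by (auto intro!: convex_Times compact_Times convex_noise_directions compact_noise_directions)
  obtain v0 where v0: "v0 \<in> V" using V by auto
  obtain u0 where u0: "u0 \<in> U" using U by auto
  have z0: "(0, v0) \<in> noise_directions V M" by (rule zero_noise_direction[OF v0])
  have "T ` X \<inter> {0} \<times> {opt..} \<noteq> {}"
  proof
    assume disj: "T ` X \<inter> {0} \<times> {opt..} = {}"
    have "\<exists>a b. (\<forall>x\<in>T ` X. a \<bullet> x < b) \<and> (\<forall>x\<in>{0} \<times> {opt..}. a \<bullet> x > b)"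
    proof (rule separating_hyperplane_compact_closed[OF _ _ _ _ _ disj])
      show "convex (T ` X)" using T X(1) by (rule convex_linear_image)
      show "compact (T ` X)"
        using X(2) T by (intro compact_continuous_image linear_continuous_on)
          (simp_all add: linear_conv_bounded_linear)
      show "T ` X \<noteq> {}" using z0 u0 by (auto simp: X_def)
    qed (auto intro!: convex_Times closed_Times)
    then obtain p s b where "\<forall>x\<in>T ` X. (p, s) \<bullet> x < b" "\<forall>x\<in>{0} \<times> {opt..}. (p, s) \<bullet> x > b"
      by (metis surj_pair)
    then have sep1: "\<And>x. x \<in> X \<Longrightarrow> (p, s) \<bullet> T x < b" and sep2: "\<And>t. opt \<le> t \<Longrightarrow> b < (p, s) \<bullet> (0, t)"
      by blast+
    have lower: "p \<bullet> (A *v (u' - u) - (2 * noise_scale) *\<^sub>R z) + s * ((1/2) * (g \<bullet> (u' - u))) < b"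
      if "u \<in> U" "u' \<in> U" "(z, v) \<in> noise_directions V M" for u u' z v
      using sep1[of "((u, u'), (z, v))"] that by (simp add: X_def T_def)
    have upper: "b < s * t" if "opt \<le> t" for t
      using sep2[OF that] by simp
    have b: "0 < b"
      using lower[OF u0 u0 z0] by simp
    have "0 < s * max opt 1"
      using b upper[of "max opt 1"] by simp
    then have s: "0 < s"
      by (simp add: zero_less_mult_iff)
    \<comment> \<open>With this factor the objective at \<open>k *\<^sub>R p\<close>, multiplied by \<open>s\<close>, is the maximum of the
      separating functional over the image of \<open>X\<close>.\<close>
    define k where "k = - 2 / s"
    have sk: "s * k = - 2" using s by (simp add: k_def)
    obtain u u' z v where w: "u \<in> U" "u' \<in> U" "(z, v) \<in> noise_directions V M"
      and eq: "objective (k *\<^sub>R p)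
        = (1/2) * ((u - u') \<bullet> (transpose A *v (k *\<^sub>R p) - g)) + noise_scale * ((k *\<^sub>R p) \<bullet> z)"
      by (rule objective_attained)
    have neg: "u - u' = - (u' - u)" by simp
    have "(u - u') \<bullet> (transpose A *v (k *\<^sub>R p)) = (k *\<^sub>R p) \<bullet> (A *v (u - u'))"
      by (metis dot_lmul_matrix inner_commute transpose_matrix_vector)
    also have "A *v (u - u') = - (A *v (u' - u))"
      by (simp only: matrix_vector_mult_diff_distrib minus_diff_eq)
    finally have tr: "(u - u') \<bullet> (transpose A *v (k *\<^sub>R p)) = - k * (p \<bullet> (A *v (u' - u)))"
      by simp
    have "s * objective (k *\<^sub>R p)
        = (s * k) * (- (1/2) * (p \<bullet> (A *v (u' - u))) + noise_scale * (p \<bullet> z)) + s * ((1/2) * (g \<bullet> (u' - u)))"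
      unfolding eq inner_diff_right[of _ _ g] tr unfolding neg inner_minus_left inner_minus_right inner_commute[of "u' - u" g] inner_scaleR_left
      by algebra
    also have "\<dots> = p \<bullet> (A *v (u' - u) - (2 * noise_scale) *\<^sub>R z) + s * ((1/2) * (g \<bullet> (u' - u)))"
      unfolding sk inner_diff_right[of p] inner_scaleR_right by algebra
    also have "\<dots> < b" using w by (rule lower)
    also have "\<dots> < s * opt" by (rule upper) simp
    also have "\<dots> \<le> s * objective (k *\<^sub>R p)"
      using s opt by (intro mult_left_mono) auto
    finally show False by simp
  qed
  then obtain y where y: "y \<in> T ` X" "y \<in> {0} \<times> {opt..}"
    unfolding ex_in_conv[symmetric] by (elim exE IntE)
  from y(1) obtain x where x: "x \<in> X" "y = T x" by (rule imageE)
  obtain u u' z v where xe: "x = ((u, u'), (z, v))" by (metis surj_pair)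
  show ?thesis
  proof (rule that)
    show "u \<in> U" "u' \<in> U" "(z, v) \<in> noise_directions V M"
      using x(1) by (simp_all add: X_def xe)
    show "A *v (u' - u) = (2 * noise_scale) *\<^sub>R z" "opt \<le> (1/2) * (g \<bullet> (u' - u))"
      using y(2) by (simp_all add: x(2) T_def xe)
  qed
qed

section \<open>Risk of the affine estimate\<close>

lemma noise_tail_bound:
  assumes "v \<in> V" "P \<in> sub_gaussian \<theta> (M v)"
  shows "measure (iid_sample K P) {\<omega> \<in> space (iid_sample K P).
      (1 / real K) * (\<Sum>i<K. f \<bullet> \<omega> i) - f \<bullet> \<theta> > noise_scale * sqrt (f \<bullet> (M v *v f))} \<le> \<epsilon> / 2"
proof -
  have "0 \<le> ln (2 / \<epsilon>)" using \<epsilon> by simp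
  from sub_gaussian_sample_tail[OF assms(2) pd[OF assms(1)] K this, of f]
  show ?thesis
    unfolding sqrt_noise_scale using \<epsilon> by (simp add: exp_minus)
qed

text \<open>
  The error of the estimate is a noise term, bounded with probability at least \<open>1 - \<epsilon>\<close> by the two
  one-sided Chernoff bounds, plus a bias. The additive constant of the estimate centres the bias: as \<open>u\<close>
  ranges over \<open>U\<close>, its largest and smallest values are opposite, with the absolute value given by
  the first term of the objective.
\<close>
lemma risk_affine_estimate_le_objective:
  "eps_risk U V A a g M K \<epsilon> (affine_estimate U A a g K f) \<le> ereal (objective f)"
  unfolding eps_risk_def
proof (intro Inf_lower imageI CollectI ballI)
  fix u v P assume u: "u \<in> U" and v: "v \<in> V" and P: "P \<in> sub_gaussian (A *v u + a) (M v)"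
  define h where "h = transpose A *v f - g"
  define t where "t = noise_scale * sqrt (f \<bullet> (M v *v f))"
  let ?\<theta> = "A *v u + a"
  let ?S = "iid_sample K P"
  define E where "E = (\<lambda>f. {\<omega> \<in> space ?S. (1 / real K) * (\<Sum>i<K. f \<bullet> \<omega> i) - f \<bullet> ?\<theta> > t})"
  have ps: "prob_space P" and sets: "sets P = sets borel"
    using P by (auto simp: sub_gaussian_def)
  interpret prob_space ?S by (intro prob_space_PiM ps)
  have [measurable]: "(\<lambda>\<zeta>. f \<bullet> \<zeta>) \<in> borel_measurable P" for f
    unfolding measurable_cong_sets[OF sets refl] by measurable
  have E_sets: "E f \<in> events" for f
    unfolding E_def by measurable
  have tail: "prob (E f) \<le> \<epsilon> / 2" "prob (E (- f)) \<le> \<epsilon> / 2"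
    using noise_tail_bound[OF v P, of f] noise_tail_bound[OF v P, of "- f"]
      matrix_vector_mult_scaleR[of "M v" "- 1" f]
    by (simp_all add: E_def t_def)
  have t_le: "t \<le> (SUP v\<in>V. noise_scale * sqrt (f \<bullet> (M v *v f)))"
    unfolding t_def using v V(3)
    by (intro cSUP_upper bounded_imp_bdd_above compact_imp_bounded compact_continuous_image
        continuous_intros continuous_on_quadratic_form)
  have "{\<omega> \<in> space ?S. \<bar>affine_estimate U A a g K f \<omega> - g \<bullet> u\<bar> > objective f} \<subseteq> E f \<union> E (- f)"
  proof (rule subsetI, rule ccontr)
    fix \<omega> assume \<omega>: "\<omega> \<in> {\<omega> \<in> space ?S. \<bar>affine_estimate U A a g K f \<omega> - g \<bullet> u\<bar> > objective f}"
      and "\<omega> \<notin> E f \<union> E (- f)"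
    then have noise: "\<bar>(1 / real K) * (\<Sum>i<K. f \<bullet> \<omega> i) - f \<bullet> ?\<theta>\<bar> \<le> t"
      by (auto simp: E_def sum_negf)
    have "f \<bullet> ?\<theta> = u \<bullet> h + g \<bullet> u + a \<bullet> f"
    proof -
      have "f \<bullet> (A *v u) = u \<bullet> (transpose A *v f)"
        by (metis dot_lmul_matrix inner_commute transpose_matrix_vector)
      then show ?thesis
        by (simp add: h_def inner_add_right inner_diff_right inner_commute)
    qed
    then have est: "affine_estimate U A a g K f \<omega> - g \<bullet> u
        = ((1 / real K) * (\<Sum>i<K. f \<bullet> \<omega> i) - f \<bullet> ?\<theta>)
          + u \<bullet> h + (1/2) * (support_fun U (- h) - support_fun U h)"
      by (simp add: affine_estimate_def h_def)
    have obj: "objective f = (1/2) * (support_fun U h + support_fun U (- h))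
        + (SUP v\<in>V. noise_scale * sqrt (f \<bullet> (M v *v f)))"
      by (simp add: est_objective_def sqrt_noise_scale[simplified] h_def)
    have "u \<bullet> h \<le> support_fun U h" "- (u \<bullet> h) \<le> support_fun U (- h)"
      using support_fun_upper[OF U(3) u, of h] support_fun_upper[OF U(3) u, of "- h"] by simp_all
    moreover have "\<bar>x + y + (1/2) * (p' - p)\<bar> \<le> (1/2) * (p + p') + r"
      if "\<bar>x\<bar> \<le> t" "t \<le> r" "y \<le> p" "- y \<le> p'" for x y p p' r :: real
      using that by (auto simp: abs_le_iff field_simps)
    ultimately have "\<bar>affine_estimate U A a g K f \<omega> - g \<bullet> u\<bar> \<le> objective f"
      unfolding est obj using noise t_le by blast
    with \<omega> show False by simp
  qed
  then have "prob {\<omega> \<in> space ?S. \<bar>affine_estimate U A a g K f \<omega> - g \<bullet> u\<bar> > objective f}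
      \<le> prob (E f \<union> E (- f))"
    by (rule finite_measure_mono) (intro sets.Un E_sets)
  also have "\<dots> \<le> prob (E f) + prob (E (- f))"
    by (intro measure_Un_le E_sets)
  also have "\<dots> \<le> \<epsilon>" using tail by simp
  finally show "prob {\<omega> \<in> space ?S. \<bar>affine_estimate U A a g K f \<omega> - g \<bullet> u\<bar> > objective f} \<le> \<epsilon>" .
qed

section \<open>The minimax lower bound\<close>

lemma sqrt_sample_noise_scale: "sqrt (real K) * noise_scale = sqrt (2 * ln (2 / \<epsilon>))"
  unfolding noise_scale_def real_sqrt_mult[symmetric] using K by simp

text \<open>
  Shrinking the worst-case pair about its midpoint by the factor \<open>\<kappa>\<close> gives two parameters in \<open>U\<close> whose
  values of the functional differ by at least \<open>2 * \<kappa> * opt\<close>. The corresponding observation means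
  differ by \<open>2 * \<kappa> * noise_scale\<close> times \<open>z\<close>, and samples from normal
  distributions on the line in the direction \<open>z\<close> with these means are compared. If \<open>\<rho> < \<kappa> * opt\<close>,
  no value of the estimate is within \<open>\<rho>\<close> of both functional values, so the estimate yields a test
  whose error probabilities violate the two-point bound.
\<close>
lemma two_point_risk_bound:
  assumes est: "est \<in> borel_estimates K"
    and adm: "\<And>u v P. u \<in> U \<Longrightarrow> v \<in> V \<Longrightarrow> P \<in> sub_gaussian (A *v u + a) (M v) \<Longrightarrow>
      measure (iid_sample K P) {\<omega> \<in> space (iid_sample K P). \<bar>est \<omega> - g \<bullet> u\<bar> > \<rho>} \<le> \<epsilon>"
    and opt: "\<And>f. opt \<le> objective f"
    and \<kappa>: "0 \<le> \<kappa>" "\<kappa> \<le> 1" "\<kappa> * sqrt (2 * ln (2 / \<epsilon>)) < std_normal_quantile (1 - \<epsilon>)"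
  shows "\<kappa> * opt \<le> \<rho>"
proof (rule ccontr)
  assume "\<not> \<kappa> * opt \<le> \<rho>"
  then have less: "\<rho> < \<kappa> * opt" by simp
  obtain u u' z v where u: "u \<in> U" "u' \<in> U" and zv: "(z, v) \<in> noise_directions V M"
    and Az: "A *v (u' - u) = (2 * noise_scale) *\<^sub>R z" and gu: "opt \<le> (1/2) * (g \<bullet> (u' - u))"
    using worst_case_pair[OF opt] by metis
  have v: "v \<in> V" and z: "\<And>f. (f \<bullet> z)\<^sup>2 \<le> f \<bullet> (M v *v f)"
    using zv by (auto simp: noise_directions_def)
  define \<delta> where "\<delta> = \<kappa> * noise_scale"
  \<comment> \<open>\<open>w (- 1)\<close> and \<open>w 1\<close> are the two shrunken points, \<open>w 0\<close> the midpoint of \<open>u\<close> and \<open>u'\<close>.\<close>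
  define w where "w = (\<lambda>s::real. ((1 - s * \<kappa>) / 2) *\<^sub>R u + ((1 + s * \<kappa>) / 2) *\<^sub>R u')"
  define b where "b = A *v (w 0) + a"
  define F where "F = (\<lambda>x::real. b + x *\<^sub>R z)"
  define P where "P = (\<lambda>s::real. distr (normal_dist (s * \<delta>)) borel F)"
  let ?N = "\<lambda>s. iid_sample K (normal_dist (s * \<delta>))"
  have w_U: "w s \<in> U" if "s = 1 \<or> s = - 1" for s
    unfolding w_def using U(2) u \<kappa>(1,2) that by (intro convexD) (auto simp: field_simps)
  have w_diff: "w s = w 0 + (s * \<kappa> / 2) *\<^sub>R (u' - u)" for s
    by (simp add: w_def algebra_simps add_divide_distrib diff_divide_distrib)
  have Aw: "A *v (w s) + a = b + (s * \<delta>) *\<^sub>R z" for s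
    by (subst w_diff) (simp add: b_def \<delta>_def matrix_vector_right_distrib matrix_vector_mult_scaleR Az mult.assoc)
  have gw: "g \<bullet> w 1 - g \<bullet> w (- 1) = \<kappa> * (g \<bullet> (u' - u))"
    unfolding w_diff[of 1] w_diff[of "- 1"] by (simp add: inner_add_right inner_diff_right algebra_simps)
  have F_meas: "F \<in> measurable (normal_dist m) borel" for m
    by (simp add: F_def)
  have P_sub: "P s \<in> sub_gaussian (A *v (w s) + a) (M v)" for s
    unfolding P_def F_def Aw by (rule line_gaussian_sub_gaussian[OF z])
  define Bad where "Bad = (\<lambda>s. {\<omega> \<in> space (iid_sample K (borel :: (real^'d) measure)). \<bar>est \<omega> - g \<bullet> w s\<bar> > \<rho>})"
  define Bad' where "Bad' = (\<lambda>s. compose {..<K} F -` Bad s \<inter> space (?N 0))"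
  have space_N: "space (?N s) = space (?N 0)" for s
    by (simp add: space_PiM)
  have sets_N: "sets (?N s) = sets (?N 0)" for s
    by (intro sets_PiM_cong) auto
  note comp = iid_sample_distr[OF prob_space_normal_dist F_meas]
  have Bad_sets: "Bad s \<in> sets (iid_sample K (borel :: (real^'d) measure))" for s
    unfolding Bad_def using est by measurable
  have Bad'_sets: "Bad' s \<in> sets (?N m)" for s m
    unfolding Bad'_def space_N[symmetric, of m] using comp(2) Bad_sets by (rule measurable_sets)
  have Bad'_prob: "measure (?N s) (Bad' s) \<le> \<epsilon>" if "s = 1 \<or> s = - 1" for s
  proof -
    have "measure (iid_sample K (P s)) {\<omega> \<in> space (iid_sample K (P s)). \<bar>est \<omega> - g \<bullet> w s\<bar> > \<rho>} \<le> \<epsilon>"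
      using w_U[OF that] v P_sub by (rule adm)
    also have "space (iid_sample K (P s)) = space (iid_sample K (borel :: (real^'d) measure))"
      by (simp add: space_PiM P_def)
    finally have "measure (iid_sample K (P s)) (Bad s) \<le> \<epsilon>"
      by (simp only: Bad_def)
    then show ?thesis
      unfolding P_def comp(1) Bad'_def space_N[of s, symmetric]
      by (simp only: measure_distr[OF comp(2) Bad_sets])
  qed
  have cover: "space (?N 1) \<subseteq> Bad' 1 \<union> Bad' (- 1)"
  proof
    fix x assume x: "x \<in> space (?N 1)"
    then have sp: "compose {..<K} F x \<in> space (iid_sample K borel)"
      by (rule measurable_space[OF comp(2)])
    have "2 * \<rho> < 2 * (\<kappa> * opt)" using less by simp
    also have "\<dots> \<le> g \<bullet> w 1 - g \<bullet> w (- 1)"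
      unfolding gw using mult_left_mono[OF gu \<kappa>(1)] by simp
    finally have "\<rho> < \<bar>est (compose {..<K} F x) - g \<bullet> w 1\<bar> \<or> \<rho> < \<bar>est (compose {..<K} F x) - g \<bullet> w (- 1)\<bar>"
      by linarith
    then show "x \<in> Bad' 1 \<union> Bad' (- 1)"
      using x sp unfolding Bad'_def Bad_def space_N[of 1] by blast
  qed
  have \<delta>: "0 \<le> \<delta>" using \<kappa>(1) noise_scale_pos by (simp add: \<delta>_def)
  have "2 * (1 - cdf std_normal_distribution (sqrt (real K) * \<delta>))
      \<le> measure (?N 1) (Bad' 1) + measure (?N (- 1)) (Bad' (- 1))"
    using two_point_testing_bound[OF K \<delta>, of "Bad' 1" "Bad' (- 1)"] Bad'_sets[of _ 1] cover by simp
  also have "\<dots> \<le> 2 * \<epsilon>"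
    using Bad'_prob[of 1] Bad'_prob[of "- 1"] by simp
  finally have "1 - \<epsilon> \<le> cdf std_normal_distribution (sqrt (real K) * \<delta>)" by simp
  moreover have "sqrt (real K) * \<delta> < std_normal_quantile (1 - \<epsilon>)"
    using \<kappa>(3) by (simp add: \<delta>_def sqrt_sample_noise_scale[symmetric] mult_ac)
  then have "cdf std_normal_distribution (sqrt (real K) * \<delta>) < 1 - \<epsilon>"
    using \<epsilon> by (intro cdf_less_if_less_std_normal_quantile) auto
  ultimately show False by simp
qed

lemma quantile_factor:
  defines "\<kappa> \<equiv> std_normal_quantile (1 - \<epsilon>) / sqrt (2 * ln (2 / \<epsilon>))"
  shows "0 < \<kappa>" "\<kappa> \<le> 1"
proof -
  have pos: "0 < sqrt (2 * ln (2 / \<epsilon>))" using \<epsilon> by simp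
  show "0 < \<kappa>"
    using std_normal_quantile_bounds(1)[OF \<epsilon>] pos unfolding \<kappa>_def by (rule divide_pos_pos)
  have "std_normal_quantile (1 - \<epsilon>) \<le> sqrt (2 * ln (1 / \<epsilon>))"
    by (rule std_normal_quantile_bounds(2)[OF \<epsilon>])
  also have "\<dots> \<le> sqrt (2 * ln (2 / \<epsilon>))"
    using \<epsilon> by (simp add: divide_right_mono)
  finally show "\<kappa> \<le> 1"
    using pos by (simp add: \<kappa>_def)
qed

text \<open>
  At the limiting factor the two error probabilities could both equal \<open>\<epsilon>\<close> without contradiction;
  the bound is therefore obtained for every factor \<open>s * \<kappa>\<close> with \<open>s < 1\<close> and extended to \<open>\<kappa>\<close> by
  passing to the limit.
\<close>
lemma minimax_risk_ge:
  assumes opt: "\<And>f. opt \<le> objective f"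
  shows "ereal (std_normal_quantile (1 - \<epsilon>) / sqrt (2 * ln (2 / \<epsilon>)) * opt)
    \<le> minimax_risk U V A a g M K \<epsilon>"
  unfolding minimax_risk_def eps_risk_def
proof (rule INF_greatest, rule Inf_greatest, elim imageE)
  define \<kappa> where "\<kappa> = std_normal_quantile (1 - \<epsilon>) / sqrt (2 * ln (2 / \<epsilon>))"
  have pos: "0 < sqrt (2 * ln (2 / \<epsilon>))" using \<epsilon> by simp
  fix est x \<rho>
  assume est: "est \<in> borel_estimates K" and x: "x = ereal \<rho>"
    and adm: "\<rho> \<in> {\<rho>. \<forall>u\<in>U. \<forall>v\<in>V. \<forall>P\<in>sub_gaussian (A *v u + a) (M v).
       measure (iid_sample K P) {\<omega> \<in> space (iid_sample K P). \<bar>est \<omega> - g \<bullet> u\<bar> > \<rho>} \<le> \<epsilon>}"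
  have "\<kappa> * opt \<le> \<rho>"
  proof (rule field_le_mult_one_interval)
    fix s :: real assume s: "0 < s" "s < 1"
    have "(s * \<kappa>) * opt \<le> \<rho>"
    proof (rule two_point_risk_bound[OF est _ opt])
      show "0 \<le> s * \<kappa>" "s * \<kappa> \<le> 1"
        using s quantile_factor by (auto simp: \<kappa>_def[symmetric] intro: mult_le_one)
      have "(s * \<kappa>) * sqrt (2 * ln (2 / \<epsilon>)) = s * std_normal_quantile (1 - \<epsilon>)"
        using pos by (simp add: \<kappa>_def)
      also have "\<dots> < std_normal_quantile (1 - \<epsilon>)"
        using s std_normal_quantile_bounds(1)[OF \<epsilon>] by simp
      finally show "(s * \<kappa>) * sqrt (2 * ln (2 / \<epsilon>)) < std_normal_quantile (1 - \<epsilon>)" .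
    qed (use adm in blast)
    then show "s * (\<kappa> * opt) \<le> \<rho>" by (simp only: mult.assoc)
  qed
  then show "ereal (std_normal_quantile (1 - \<epsilon>) / sqrt (2 * ln (2 / \<epsilon>)) * opt) \<le> x"
    unfolding x \<kappa>_def[symmetric] by simp
qed

end

theorem proposition4p2:
  fixes U :: "(real^'n) set" and V :: "(real^'m) set"
    and A :: "real^'n^'d" and a :: "real^'d" and g :: "real^'n"
    and M :: "real^'m \<Rightarrow> real^'d^'d"
    and K :: nat and \<epsilon> :: real
  assumes "K \<ge> 1" and "0 < \<epsilon>" and "\<epsilon> < 1/2"
    and "U \<noteq> {}" and "convex U" and "compact U"
    and "V \<noteq> {}" and "convex V" and "compact V"
    and "affine_map M" and "\<And>v. transpose (M v) = M v"
    and "\<And>v. v \<in> V \<Longrightarrow> pos_def (M v)"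
  shows "(\<exists>f. is_arg_min (est_objective U V A g M K \<epsilon>) (\<lambda>_. True) f)
    \<and> (\<forall>f. is_arg_min (est_objective U V A g M K \<epsilon>) (\<lambda>_. True) f \<longrightarrow>
          eps_risk U V A a g M K \<epsilon> (affine_estimate U A a g K f) \<le> ereal (est_opt U V A g M K \<epsilon>))
    \<and> ereal (est_opt U V A g M K \<epsilon>)
        \<le> ereal (sqrt (2 * ln (2/\<epsilon>)) / std_normal_quantile (1 - \<epsilon>)) * minimax_risk U V A a g M K \<epsilon>
    \<and> ((\<lambda>\<delta>. sqrt (2 * ln (2/\<delta>)) / std_normal_quantile (1 - \<delta>)) \<longlongrightarrow> 1) (at_right 0)"
proof -
  interpret recovery_problem U V A g M K \<epsilon>
    using assms by unfold_locales auto
  obtain f where f: "\<And>h. objective f \<le> objective h"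
    using objective_attains_min by blast
  have "is_arg_min objective (\<lambda>_. True) f"
    using f by (auto simp: is_arg_min_def not_less)
  moreover have "eps_risk U V A a g M K \<epsilon> (affine_estimate U A a g K h)
      \<le> ereal (est_opt U V A g M K \<epsilon>)" if "is_arg_min objective (\<lambda>_. True) h" for h
  proof -
    have "objective h \<le> objective f'" for f'
      using that by (auto simp: is_arg_min_def not_less)
    then have "est_opt U V A g M K \<epsilon> = objective h" by (rule est_opt_eq_min)
    then show ?thesis by (simp only: risk_affine_estimate_le_objective)
  qed
  moreover have "ereal (est_opt U V A g M K \<epsilon>)
      \<le> ereal (sqrt (2 * ln (2/\<epsilon>)) / std_normal_quantile (1 - \<epsilon>)) * minimax_risk U V A a g M K \<epsilon>"
  proof -
    let ?q = "std_normal_quantile (1 - \<epsilon>)" and ?s = "sqrt (2 * ln (2 / \<epsilon>))"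
    have pos: "0 < ?q" "0 < ?s"
      using std_normal_quantile_bounds(1)[OF \<epsilon>] \<epsilon> by simp_all
    have "ereal (est_opt U V A g M K \<epsilon>) = ereal (?s / ?q) * ereal (?q / ?s * objective f)"
      using pos est_opt_eq_min[OF f] by simp
    also have "\<dots> \<le> ereal (?s / ?q) * minimax_risk U V A a g M K \<epsilon>"
      using pos minimax_risk_ge[OF f, of a] by (intro ereal_mult_left_mono) auto
    finally show ?thesis .
  qed
  ultimately show ?thesis
    using std_normal_quantile_asymp by blast
qed

end
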